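(* Let $F=I_2(f)$ with $f\in\mathfrak H^{\odot2}$ given by $f=\sum_{i=1}^\infty\lambda_ie_i\otimes e_i$, where $|\lambda_1|\ge|\lambda_2|\ge\cdots$ are the eigenvalues of the Hilbert–Schmidt operator corresponding to $f$ and $\{e_i\}_{i\ge1}$ are the corresponding eigenvectors, forming an orthonormal basis of $\mathfrak H$. Let $m\ge0$ be an integer and assume that there exists $N>6m+6\left(\lfloor\frac m2\rfloor\vee1\right)$ such that $\lambda_N\ne0$. Then $F$ admits an $m$ times continuously differentiable density $f_F$. Furthermore, if $\phi$ denotes the density of $N(0,E[F^2])$, then for $k=0,1,\dots,m$, $$\sup_{x\in\mathbb R}\left|f_F^{(k)}(x)-\phi^{(k)}(x)\right|\le C\left(\sum_{i=1}^\infty\lambda_i^4\right)^{\frac12}\le C\left(E[F^4]-3(E[F^2])^2\right)^{\frac12},$$ where the constant $C$ depends on $N$ and $\lambda_N$.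
   Context: $\mathfrak H$ is a real separable Hilbert space and $X=\{X(h),h\in\mathfrak H\}$ is an isonormal Gaussian process: a centered Gaussian family with $E[X(h)X(g)]=\langle h,g\rangle_{\mathfrak H}$. $\mathfrak H^{\odot2}$ is the symmetric tensor product, and $I_2:\mathfrak H^{\odot 2}\to L^2(\Omega)$ is the double stochastic integral, i.e. the linear map with $I_2(h^{\otimes2})=X(h)^2-1$ for $\|h\|_{\mathfrak H}=1$, and $E[I_2(f)^2]=2\|f\|^2_{\mathfrak H^{\otimes2}}$. Thus $F=\sum_{i=1}^\infty\lambda_i(X(e_i)^2-1)$. Every $f\in\mathfrak H^{\odot2}$ has an expansion of the stated form. Here $a\vee b=\max(a,b)$. *)

theory Defs
  imports "HOL-Probability.Probability"
begin

text \<open>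
  The Hilbert space tensor product is determined up to a unitary isomorphism by the following
  properties: a complete inner product space \<open>'k\<close> together with a bilinear map \<open>T\<close>, whose
  value \<open>T h g\<close> is the elementary tensor of \<open>h\<close> and \<open>g\<close>, such that the inner product of
  elementary tensors is the product of the inner products and elementary tensors are total.
\<close>

definition hilbert_tensor_square ::
  "('h::{real_inner, complete_space} \<Rightarrow> 'h \<Rightarrow> 'k::{real_inner, complete_space}) \<Rightarrow> bool" where
  "hilbert_tensor_square T \<longleftrightarrow>
     bilinear T \<and>
     (\<forall>a b c d. inner (T a b) (T c d) = inner a c * inner b d) \<and>
     closure (span {T a b | a b. True}) = UNIV"

text \<open>The norm on the symmetric tensors is the one inherited from the full tensor product.\<close>

definition symmetric_tensors :: "('h \<Rightarrow> 'h \<Rightarrow> 'k::real_inner) \<Rightarrow> 'k set" where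
  "symmetric_tensors T = closure (span {(1/2) *\<^sub>R (T a b + T b a) | a b. True})"

text \<open>
  The description is well defined by the Riesz representation theorem; the operator it selects
  is the one through which a square-integrable kernel acts.
\<close>

definition hilbert_schmidt_operator ::
  "('h::real_inner \<Rightarrow> 'h \<Rightarrow> 'k::real_inner) \<Rightarrow> 'k \<Rightarrow> 'h \<Rightarrow> 'h" where
  "hilbert_schmidt_operator T f = (THE A. \<forall>h g. inner (A h) g = inner f (T h g))"

definition orthonormal_basis :: "(nat \<Rightarrow> 'h::real_inner) \<Rightarrow> bool" where
  "orthonormal_basis e \<longleftrightarrow>
     (\<forall>i j. inner (e i) (e j) = (if i = j then 1 else 0)) \<and> closure (span (range e)) = UNIV"

text \<open>The degenerate case of variance zero is included, since \<open>normal_density 0 0\<close> is not a density.\<close>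

definition centered_gaussian :: "'w measure \<Rightarrow> ('w \<Rightarrow> real) \<Rightarrow> bool" where
  "centered_gaussian M Y \<longleftrightarrow>
     Y \<in> borel_measurable M \<and>
     ((AE w in M. Y w = 0) \<or> (\<exists>\<sigma>>0. distributed M lborel Y (normal_density 0 \<sigma>)))"

text \<open>A Gaussian family is one all of whose finite linear combinations are Gaussian.\<close>

definition isonormal_process ::
  "'w measure \<Rightarrow> ('h::real_inner \<Rightarrow> 'w \<Rightarrow> real) \<Rightarrow> bool" where
  "isonormal_process M X \<longleftrightarrow>
     (\<forall>S c. finite S \<longrightarrow> centered_gaussian M (\<lambda>w. \<Sum>h\<in>S. c h * X h w)) \<and>
     (\<forall>h g. (\<integral>w. X h w * X g w \<partial>M) = inner h g)"

text \<open>
  Elements of \<open>L\<^sup>2\<close> are represented by square-integrable functions, so identities between them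
  hold almost everywhere. The values of \<open>I2\<close> outside the symmetric tensors are irrelevant.
\<close>

definition double_stochastic_integral ::
  "'w measure \<Rightarrow> ('h \<Rightarrow> 'h \<Rightarrow> 'k) \<Rightarrow> ('h::real_inner \<Rightarrow> 'w \<Rightarrow> real) \<Rightarrow>
   ('k::real_inner \<Rightarrow> 'w \<Rightarrow> real) \<Rightarrow> bool" where
  "double_stochastic_integral M T X I2 \<longleftrightarrow>
     (\<forall>f\<in>symmetric_tensors T.
        I2 f \<in> borel_measurable M \<and> integrable M (\<lambda>w. (I2 f w)\<^sup>2)) \<and>
     (\<forall>f\<in>symmetric_tensors T. \<forall>g\<in>symmetric_tensors T. \<forall>a b.
        AE w in M. I2 (a *\<^sub>R f + b *\<^sub>R g) w = a * I2 f w + b * I2 g w) \<and>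
     (\<forall>h. norm h = 1 \<longrightarrow> (AE w in M. I2 (T h h) w = (X h w)\<^sup>2 - 1)) \<and>
     (\<forall>f\<in>symmetric_tensors T. (\<integral>w. (I2 f w)\<^sup>2 \<partial>M) = 2 * (norm f)\<^sup>2)"

definition continuously_differentiable :: "nat \<Rightarrow> (real \<Rightarrow> real) \<Rightarrow> bool" where
  "continuously_differentiable m g \<longleftrightarrow>
     (\<forall>k<m. \<forall>x. (deriv ^^ k) g differentiable at x) \<and> continuous_on UNIV ((deriv ^^ m) g)"

end

theory Submission
  imports Defs
begin

text \<open>
  The sum of the \<open>\<lambda>\<^sub>i\<^sup>4\<close> is at least \<open>\<lambda>\<^sub>N\<^sup>4\<close>, so with a constant depending on \<open>\<lambda>\<^sub>N\<close> it suffices to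
  bound the derivatives of both densities uniformly. The variables \<open>X(e\<^sub>i)\<close> are independent standard
  normal, hence the characteristic function of \<open>F\<close> is bounded by the product of the
  \<open>(1 + 4 \<lambda>\<^sub>i\<^sup>2 t\<^sup>2)\<close> to the power \<open>-1/4\<close> over \<open>i \<le> N\<close>; the Gaussian one with the same variance has
  the same bound, and Fourier inversion does the rest. The fourth cumulant of \<open>F\<close> is at
  least \<open>48 \<Sum> \<lambda>\<^sub>i\<^sup>4\<close>, as a limit of the fourth cumulants of the partial sums.
\<close>

text \<open>Each factor of the characteristic function decays like \<open>|t|^(-1/2)\<close>, so
  \<open>N\<close> of them give \<open>|t|^(-N/2)\<close>. A derivative of order \<open>k\<close> of
  the Fourier integral costs \<open>|t|^k\<close>, and continuity of the \<open>m\<close>-th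
  derivative costs one power more. Comparison with \<open>1/(1+t^2)\<close> at order
  \<open>m+1\<close> is possible exactly when \<open>2*m+6 <= N\<close>. The Gaussian side has the
  same decay because its variance \<open>2 * sum lam_i^2\<close> is at least
  \<open>2*N*lam_N^2\<close> and \<open>1+x <= exp x\<close>. The bound \<open>K\<close> so obtained
  for the difference of the derivatives becomes \<open>C = K / lam_N^2\<close>, since
  \<open>lam_N^2 = sqrt (lam_N^4)\<close>. Two obstacles shape the proof. Joint Gaussianity is given
  only through linear combinations, hence through joint characteristic functions; independence is
  extracted with one-dimensional Levy uniqueness alone, applied after changes of the probability
  measure. Moreover \<open>F\<close> is known only to be square integrable: the existence of its
  fourth moment comes from Fatou's lemma, and the cumulant estimate is a one-sided comparison with
  partial sums rather than a convergence of fourth moments.\<close>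

section \<open>Independence from joint characteristic functions\<close>

text \<open>If \<open>W\<close> has positive mean, \<open>W / e\<close> is the density of a
  probability measure under which \<open>V\<close> has an unchanged characteristic function, hence
  by Levy uniqueness an unchanged law. If the mean is zero, \<open>W\<close> vanishes almost
  everywhere. The weight carries the information on a second variable, so that no two-dimensional
  uniqueness theorem enters.\<close>

lemma (in prob_space) weighted_char_factor:
  fixes W V :: "'a \<Rightarrow> real"
  assumes [measurable]: "W \<in> borel_measurable M" "V \<in> borel_measurable M"
    and W: "integrable M W" "\<And>w. 0 \<le> W w"
    and char: "\<And>t. (CLINT w|M. W w *\<^sub>R iexp (t * V w)) = of_real (expectation W) * (CLINT w|M. iexp (t * V w))"
    and A [measurable]: "A \<in> sets borel"
  shows "expectation (\<lambda>w. W w * indicator A (V w)) = expectation W * prob {w\<in>space M. V w \<in> A}"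
proof (cases "expectation W = 0")
  case True
  then have "AE w in M. W w = 0"
    using integral_nonneg_eq_0_iff_AE[OF W(1)] W(2) by simp
  then have "expectation (\<lambda>w. W w * indicator A (V w)) = 0"
    by (intro integral_eq_zero_AE) auto
  with True show ?thesis by simp
next
  case False
  define e where "e = expectation W"
  have "0 \<le> e" unfolding e_def using W(2) by simp
  with False have e: "e > 0" by (simp add: e_def)
  define D where "D = density M (\<lambda>w. ennreal (W w / e))"
  have [simp]: "sets D = sets M" "space D = space M" by (auto simp: D_def)
  have D_int: "integral\<^sup>L D g = integral\<^sup>L M (\<lambda>w. (W w / e) *\<^sub>R g w)"
    if "g \<in> borel_measurable M" for g :: "'a \<Rightarrow> 'b::{banach, second_countable_topology}"
    unfolding D_def using that W e by (subst integral_density) auto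
  have "(\<integral>\<^sup>+w. ennreal (W w / e) \<partial>M) = ennreal (expectation (\<lambda>w. W w / e))"
    using W e by (intro nn_integral_eq_integral) auto
  also have "expectation (\<lambda>w. W w / e) = 1"
    using e by (simp add: e_def)
  finally have "emeasure D (space D) = 1"
    by (simp add: D_def emeasure_density)
  then interpret D: prob_space D by (rule prob_spaceI)
  have V [measurable]: "V \<in> borel_measurable D" by (simp add: measurable_def)
  have "distr D borel V = distr M borel V"
  proof (rule Levy_uniqueness)
    show "real_distribution (distr D borel V)" by (rule D.real_distribution_distr) simp
    show "real_distribution (distr M borel V)" by (rule real_distribution_distr) simp
    show "char (distr D borel V) = char (distr M borel V)"
    proof
      fix t
      have "char (distr D borel V) t = (CLINT w|D. iexp (t * V w))"
        by (simp add: char_def integral_distr)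
      also have "\<dots> = (CLINT w|M. (1/e) *\<^sub>R (W w *\<^sub>R iexp (t * V w)))"
        by (subst D_int) (auto simp: field_simps)
      also have "\<dots> = (1/e) *\<^sub>R (CLINT w|M. W w *\<^sub>R iexp (t * V w))"
        by (rule integral_scaleR_right)
      also have "\<dots> = (CLINT w|M. iexp (t * V w))"
        unfolding char e_def[symmetric] using e by (simp add: scaleR_conv_of_real)
      finally show "char (distr D borel V) t = char (distr M borel V) t"
        by (simp add: char_def integral_distr)
    qed
  qed
  then have "measure (distr D borel V) A = measure (distr M borel V) A" by simp
  then have "measure D (V -` A \<inter> space M) = prob (V -` A \<inter> space M)"
    by (simp add: measure_distr)
  moreover have "measure D (V -` A \<inter> space M) = integral\<^sup>L D (indicator (V -` A \<inter> space M))"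
    by simp
  moreover have "\<dots> = expectation (\<lambda>w. (W w / e) *\<^sub>R indicator (V -` A \<inter> space M) w)"
    by (rule D_int) measurable
  moreover have "\<dots> = expectation (\<lambda>w. (W w * indicator A (V w)) / e)"
    by (intro Bochner_Integration.integral_cong) (auto simp: indicator_def)
  moreover have "\<dots> = expectation (\<lambda>w. W w * indicator A (V w)) / e" by simp
  moreover have "V -` A \<inter> space M = {w\<in>space M. V w \<in> A}" by auto
  ultimately show ?thesis using e by (simp add: e_def field_simps)
qed

text \<open>
  The weight \<open>1 + Re (z e\<^sup>i\<^sup>U)\<close> is nonnegative, so that it defines a change of measure under which
  \<open>V\<close> keeps its law; the choices \<open>z = 1\<close> and \<open>z = -\<i>\<close> give the two parts of the claim.
\<close>

lemma (in prob_space) char_factor_indicator: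
  fixes U V :: "'a \<Rightarrow> real"
  assumes [measurable]: "U \<in> borel_measurable M" "V \<in> borel_measurable M"
    and fac: "\<And>s t. (CLINT w|M. iexp (s * U w + t * V w)) =
       (CLINT w|M. iexp (s * U w)) * (CLINT w|M. iexp (t * V w))"
    and A [measurable]: "A \<in> sets borel"
  shows "(CLINT w|M. indicator A (V w) *\<^sub>R iexp (U w)) =
    prob {w\<in>space M. V w \<in> A} *\<^sub>R (CLINT w|M. iexp (U w))"
proof -
  have bnd: "integrable M f" if "f \<in> borel_measurable M" "\<And>w. norm (f w) \<le> B" for f :: "'a \<Rightarrow> 'b::{banach, second_countable_topology}" and B
    using that by (intro integrable_const_bound[of _ B]) auto
  have *: "Re (z * (CLINT w|M. indicator A (V w) *\<^sub>R iexp (U w))) =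
      Re (z * (prob {w\<in>space M. V w \<in> A} *\<^sub>R (CLINT w|M. iexp (U w))))" if z: "norm z = 1" for z
  proof -
    define W where "W = (\<lambda>w. 1 + Re (z * iexp (U w)))"
    have n1: "norm (z * iexp (U w)) = 1" for w using z by (simp add: norm_mult)
    have W0: "0 \<le> W w" and W2: "W w \<le> 2" for w
      using abs_Re_le_cmod[of "z * iexp (U w)"] unfolding n1 W_def by linarith+
    have Wm [measurable]: "W \<in> borel_measurable M" unfolding W_def by measurable
    have iW: "integrable M W" by (rule bnd[of _ 2]) (use W0 W2 in \<open>auto\<close>)
    \<comment> \<open>The weight is a combination of 1, \<open>iexp (U w)\<close> and
      \<open>iexp (- U w)\<close>, so \<open>fac\<close> is needed only at \<open>s = 1\<close> and
      \<open>s = -1\<close>.\<close>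
    have We: "of_real (W w) = 1 + (z * iexp (U w) + cnj z * iexp (- U w)) / 2" for w
    proof -
      have "cnj (z * iexp (U w)) = cnj z * iexp (- U w)"
        by (simp add: exp_cnj)
      then show ?thesis
        using complex_add_cnj[of "z * iexp (U w)"] by (simp add: W_def del: complex_cnj_mult times_complex.sel)
    qed
    have ii: "integrable M (\<lambda>w. c * iexp (f w))" if "f \<in> borel_measurable M" for c and f :: "'a \<Rightarrow> real"
      by (rule bnd[of _ "norm c"]) (use that in \<open>auto simp: norm_mult\<close>)
    have ch: "(CLINT w|M. W w *\<^sub>R iexp (t * V w)) =
        (CLINT w|M. iexp (t * V w)) * (1 + (z * (CLINT w|M. iexp (U w)) + cnj z * (CLINT w|M. iexp (- U w))) / 2)" for t
    proof -
      have "(CLINT w|M. W w *\<^sub>R iexp (t * V w)) =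
        (CLINT w|M. 1 * iexp (t * V w) + ((z/2) * iexp (1 * U w + t * V w) + (cnj z/2) * iexp ((-1) * U w + t * V w)))"
      proof (intro Bochner_Integration.integral_cong refl)
        fix w
        have "iexp (1 * U w + t * V w) = iexp (U w) * iexp (t * V w)"
          and "iexp ((-1) * U w + t * V w) = iexp (- U w) * iexp (t * V w)"
          by (simp_all add: distrib_left right_diff_distrib flip: exp_add)
        moreover have "(1 + (z * a + cnj z * b) / 2) * x = 1 * x + ((z/2) * (a * x) + (cnj z/2) * (b * x))" for a b x
          by (simp add: field_simps)
        ultimately show "W w *\<^sub>R iexp (t * V w) =
            1 * iexp (t * V w) + ((z/2) * iexp (1 * U w + t * V w) + (cnj z/2) * iexp ((-1) * U w + t * V w))"
          by (simp only: scaleR_conv_of_real We)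
      qed
      also have "\<dots> = 1 * (CLINT w|M. iexp (t * V w)) + ((z/2) * (CLINT w|M. iexp (1 * U w + t * V w)) + (cnj z/2) * (CLINT w|M. iexp ((-1) * U w + t * V w)))"
        by (intro Bochner_Integration.integral_add[THEN trans] arg_cong2[of _ _ _ _ "(+)"]
              integral_mult_right_zero refl Bochner_Integration.integrable_add ii) auto
      also have "\<dots> = (CLINT w|M. iexp (t * V w)) * (1 + (z * (CLINT w|M. iexp (1*U w)) + cnj z * (CLINT w|M. iexp ((-1) * U w))) / 2)"
        unfolding fac by (simp add: algebra_simps add_divide_distrib)
      finally show ?thesis by simp
    qed
    \<comment> \<open>Evaluation of \<open>ch\<close> at \<open>t = 0\<close> identifies the bracket
      there as the mean of \<open>W\<close>.\<close>
    have EW: "of_real (expectation W) = 1 + (z * (CLINT w|M. iexp (U w)) + cnj z * (CLINT w|M. iexp (- U w))) / 2"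
      using ch[of 0] by (simp add: scaleR_conv_of_real prob_space del: of_real_add)
    have eq: "expectation (\<lambda>w. W w * indicator A (V w)) = expectation W * prob {w\<in>space M. V w \<in> A}"
      by (rule weighted_char_factor) (use iW W0 ch EW in \<open>auto simp: mult.commute\<close>)
    have i1: "integrable M (\<lambda>w. indicator A (V w) *\<^sub>R iexp (U w))"
      by (rule bnd[of _ 1]) (auto simp: indicator_def)
    have i1': "integrable M (\<lambda>w. z * (indicator A (V w) *\<^sub>R iexp (U w)))"
      by (intro integrable_mult_right i1)
    have i2: "integrable M (\<lambda>w. indicator A (V w) :: real)"
      by (rule bnd[of _ 1]) (auto simp: indicator_def)
    have i3: "integrable M (\<lambda>w. z * iexp (U w))" by (rule ii) simp
    have pA: "expectation (\<lambda>w. indicator A (V w)) = prob {w\<in>space M. V w \<in> A}"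
    proof -
      have "expectation (\<lambda>w. indicator A (V w)) = expectation (indicator {w\<in>space M. V w \<in> A})"
        by (intro Bochner_Integration.integral_cong) (auto simp: indicator_def)
      also have "\<dots> = prob {w\<in>space M. V w \<in> A}" by simp
      finally show ?thesis .
    qed
    have "expectation (\<lambda>w. W w * indicator A (V w)) =
      expectation (\<lambda>w. indicator A (V w) + Re (z * (indicator A (V w) *\<^sub>R iexp (U w))))"
      by (intro Bochner_Integration.integral_cong refl) (auto simp: W_def indicator_def)
    also have "\<dots> = expectation (\<lambda>w. indicator A (V w)) + expectation (\<lambda>w. Re (z * (indicator A (V w) *\<^sub>R iexp (U w))))"
      by (rule Bochner_Integration.integral_add[OF i2 integrable_Re[OF i1']])
    also have "expectation (\<lambda>w. Re (z * (indicator A (V w) *\<^sub>R iexp (U w)))) =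
        Re (CLINT w|M. z * (indicator A (V w) *\<^sub>R iexp (U w)))"
      by (rule integral_Re[OF i1'])
    also have "(CLINT w|M. z * (indicator A (V w) *\<^sub>R iexp (U w))) = z * (CLINT w|M. indicator A (V w) *\<^sub>R iexp (U w))"
      by (rule integral_mult_right_zero)
    finally have "expectation (\<lambda>w. W w * indicator A (V w)) =
        prob {w\<in>space M. V w \<in> A} + Re (z * (CLINT w|M. indicator A (V w) *\<^sub>R iexp (U w)))"
      by (simp only: pA)
    moreover have "expectation W = 1 + Re (z * (CLINT w|M. iexp (U w)))"
      unfolding W_def using i3 by (simp add: integrable_Re prob_space integral_Re del: times_complex.sel)
    ultimately show ?thesis using eq by (simp add: algebra_simps)
  qed
  show ?thesis
    using *[of 1] *[of "-\<i>"] by (auto intro!: complex_eqI)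
qed

text \<open>
  Quantifying over the measure lets the induction condition on \<open>X k \<in> A k\<close>: this conditioning does
  not change the joint characteristic function of the remaining variables.
\<close>

lemma char_factor_prob:
  fixes X :: "'i \<Rightarrow> 'a \<Rightarrow> real" and \<mu> :: "'i \<Rightarrow> real measure"
  assumes "finite J"
    and "prob_space M" "\<And>j. j \<in> J \<Longrightarrow> X j \<in> borel_measurable M"
    and "\<And>j. j \<in> J \<Longrightarrow> real_distribution (\<mu> j)"
    and "\<And>c. (CLINT w|M. iexp (\<Sum>j\<in>J. c j * X j w)) = (\<Prod>j\<in>J. char (\<mu> j) (c j))"
    and "\<And>j. j \<in> J \<Longrightarrow> A j \<in> sets borel"
  shows "measure M {w\<in>space M. \<forall>j\<in>J. X j w \<in> A j} = (\<Prod>j\<in>J. measure (\<mu> j) (A j))"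
  using assms
proof (induction J arbitrary: M rule: finite_induct)
  case empty
  then show ?case by (simp add: prob_space.prob_space)
next
  case (insert k J)
  interpret prob_space M by fact
  have [measurable]: "X k \<in> borel_measurable M" "A k \<in> sets borel"
    and Xm: "\<And>j. j \<in> J \<Longrightarrow> X j \<in> borel_measurable M" and Am: "\<And>j. j \<in> J \<Longrightarrow> A j \<in> sets borel"
    using insert.prems by auto
  have ch0: "char (\<mu> j) 0 = 1" if "j \<in> insert k J" for j
    using insert.prems(3)[OF that] by (rule real_distribution.char_zero)
  have joint: "(CLINT w|M. iexp (s * (\<Sum>j\<in>J. c j * X j w) + t * X k w)) =
     (\<Prod>j\<in>J. char (\<mu> j) (s * c j)) * char (\<mu> k) t" for s t c
  proof -
    \<comment> \<open>The extra scalar \<open>s\<close> on the block \<open>J\<close> lets one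
      identity serve both for the joint law (\<open>s = 1\<close>) and for \<open>X k\<close> alone
      (\<open>s = 0\<close>).\<close>
    let ?c = "\<lambda>j. if j = k then t else s * c j"
    have "(\<Sum>j\<in>J. ?c j * X j w) = s * (\<Sum>j\<in>J. c j * X j w)" for w
      unfolding sum_distrib_left using insert.hyps by (intro sum.cong) (auto simp: mult.assoc)
    then have 1: "(\<Sum>j\<in>insert k J. ?c j * X j w) = s * (\<Sum>j\<in>J. c j * X j w) + t * X k w" for w
      using insert.hyps by simp
    have 2: "(\<Prod>j\<in>J. char (\<mu> j) (?c j)) = (\<Prod>j\<in>J. char (\<mu> j) (s * c j))"
      using insert.hyps by (intro prod.cong) auto
    show ?thesis
      using insert.prems(4)[of ?c] insert.hyps unfolding 1 by (simp add: 2)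
  qed
  have k_law: "(CLINT w|M. iexp (t * X k w)) = char (\<mu> k) t" for t
    using joint[of 0 "\<lambda>_. 0" t] ch0 by simp
  have "distr M borel (X k) = \<mu> k"
  proof (intro Levy_uniqueness real_distribution_distr insert.prems ext)
    show "char (distr M borel (X k)) t = char (\<mu> k) t" for t
      unfolding k_law[symmetric] by (simp add: char_def integral_distr)
  qed auto
  with insert.prems have pk: "prob {w\<in>space M. X k w \<in> A k} = measure (\<mu> k) (A k)"
    using measure_distr[of "X k" M borel "A k"] by (simp add: vimage_def Int_def conj_commute)
  define B where "B = {w\<in>space M. X k w \<in> A k}"
  have B [measurable]: "B \<in> sets M" unfolding B_def by measurable
  have split: "{w\<in>space M. \<forall>j\<in>insert k J. X j w \<in> A j} = B \<inter> {w\<in>space M. \<forall>j\<in>J. X j w \<in> A j}"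
    by (auto simp: B_def)
  have C: "{w\<in>space M. \<forall>j\<in>J. X j w \<in> A j} \<in> sets M"
    using insert.hyps Xm Am by measurable
  show ?case
  \<comment> \<open>Conditioning on \<open>B\<close> requires positive probability; on a null event
    both sides are 0.\<close>
  proof (cases "prob B = 0")
    case True
    have "measure M {w\<in>space M. \<forall>j\<in>insert k J. X j w \<in> A j} \<le> prob B"
      unfolding split by (intro finite_measure_mono) auto
    with True have "measure M {w\<in>space M. \<forall>j\<in>insert k J. X j w \<in> A j} = 0"
      by (simp add: measure_le_0_iff)
    with True pk insert.hyps show ?thesis by (simp add: B_def)
  next
    case False
    then have pB: "prob B > 0" by (simp add: zero_less_measure_iff)
    define D where "D = uniform_measure M B"
    have eB: "emeasure M B \<noteq> 0" "emeasure M B \<noteq> \<infinity>" using False by (auto simp: emeasure_eq_measure)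
    interpret D: prob_space D unfolding D_def using eB by (rule prob_space_uniform_measure)
    have spD: "space D = space M" by (simp add: D_def)
    have setsD: "sets D = sets M" by (simp add: D_def)
    have D_int: "integral\<^sup>L D g = (1 / prob B) *\<^sub>R (CLINT w|M. indicator B w *\<^sub>R g w)"
      if [measurable]: "g \<in> borel_measurable M" for g :: "'a \<Rightarrow> complex"
    proof -
      have "D = density M (\<lambda>w. ennreal (indicator B w / prob B))"
        unfolding D_def uniform_measure_def using pB
        by (intro density_cong) (auto simp: emeasure_eq_measure indicator_def divide_ennreal simp flip: ennreal_1)
      then have "integral\<^sup>L D g = (CLINT w|M. (indicator B w / prob B) *\<^sub>R g w)"
        by (simp add: integral_density)
      also have "\<dots> = (CLINT w|M. (1 / prob B) *\<^sub>R (indicator B w *\<^sub>R g w))"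
        by (intro Bochner_Integration.integral_cong) auto
      also have "\<dots> = (1 / prob B) *\<^sub>R (CLINT w|M. indicator B w *\<^sub>R g w)"
        by (rule integral_scaleR_right)
      finally show ?thesis .
    qed
    \<comment> \<open>The laws \<open>\<mu> j\<close> are fixed in advance and not computed from the
      measure, so the hypothesis applies to the conditioned measure with the same right-hand
      side.\<close>
    have IH: "measure D {w\<in>space D. \<forall>j\<in>J. X j w \<in> A j} = (\<Prod>j\<in>J. measure (\<mu> j) (A j))"
    proof (rule insert.IH)
      show "prob_space D" by (rule D.prob_space_axioms)
      show "X j \<in> borel_measurable D" if "j \<in> J" for j
        using Xm[OF that] setsD by (simp cong: measurable_cong_sets)
      show "(CLINT w|D. iexp (\<Sum>j\<in>J. c j * X j w)) = (\<Prod>j\<in>J. char (\<mu> j) (c j))" for c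
      proof -
        let ?U = "\<lambda>w. \<Sum>j\<in>J. c j * X j w"
        have U [measurable]: "?U \<in> borel_measurable M" using Xm by measurable
        have Ue: "(\<lambda>w. iexp (?U w)) \<in> borel_measurable M" by measurable
        have "(CLINT w|M. indicator (A k) (X k w) *\<^sub>R iexp (?U w)) =
           prob {w\<in>space M. X k w \<in> A k} *\<^sub>R (CLINT w|M. iexp (?U w))"
        proof (rule char_factor_indicator)
          fix s t
          show "(CLINT w|M. iexp (s * ?U w + t * X k w)) = (CLINT w|M. iexp (s * ?U w)) * (CLINT w|M. iexp (t * X k w))"
            using joint[of s c t] joint[of s c 0] k_law[of t] ch0 by simp
        qed measurable
        moreover have "(CLINT w|M. indicator B w *\<^sub>R iexp (?U w)) = (CLINT w|M. indicator (A k) (X k w) *\<^sub>R iexp (?U w))"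
          by (intro Bochner_Integration.integral_cong) (auto simp: B_def indicator_def)
        moreover have "(CLINT w|M. iexp (?U w)) = (\<Prod>j\<in>J. char (\<mu> j) (c j))"
          using joint[of 1 c 0] ch0 by simp
        ultimately show ?thesis using False by (subst D_int[OF Ue]) (auto simp: B_def)
      qed
    qed (use insert.prems in auto)
    have "measure D {w\<in>space M. \<forall>j\<in>J. X j w \<in> A j} =
        prob (B \<inter> {w\<in>space M. \<forall>j\<in>J. X j w \<in> A j}) / prob B"
      unfolding D_def using eB B C by (subst measure_uniform_measure) auto
    with IH have "prob (B \<inter> {w\<in>space M. \<forall>j\<in>J. X j w \<in> A j}) = prob B * (\<Prod>j\<in>J. measure (\<mu> j) (A j))"
      using False by (simp add: spD field_simps)
    then show ?thesis unfolding split using pk insert.hyps by (simp add: B_def)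
  qed
qed

text \<open>Independence of the generated sigma-algebras is a product formula for finitely many
  events \<open>X j\<close> in \<open>B j\<close>. This is \<open>char_factor_prob\<close> with
  \<open>\<mu> j\<close> taken to be the law of \<open>X j\<close>.\<close>

lemma (in prob_space) indep_vars_if_char_factor:
  fixes X :: "'i \<Rightarrow> 'a \<Rightarrow> real"
  assumes X: "\<And>j. j \<in> I \<Longrightarrow> X j \<in> borel_measurable M"
    and char: "\<And>J c. finite J \<Longrightarrow> J \<subseteq> I \<Longrightarrow>
      (CLINT w|M. iexp (\<Sum>j\<in>J. c j * X j w)) = (\<Prod>j\<in>J. CLINT w|M. iexp (c j * X j w))"
  shows "indep_vars (\<lambda>_. borel) X I"
  unfolding indep_vars_def2
proof (intro conjI ballI indep_setsI)
  fix J A assume J: "J \<noteq> {}" "J \<subseteq> I" "finite J"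
    and A: "\<forall>j\<in>J. A j \<in> {X j -` A \<inter> space M |A. A \<in> sets borel}"
  then obtain B where B: "\<And>j. j \<in> J \<Longrightarrow> B j \<in> sets borel" "\<And>j. j \<in> J \<Longrightarrow> A j = X j -` B j \<inter> space M"
    by (simp add: Bex_def) metis
  have Xm: "\<And>j. j \<in> J \<Longrightarrow> X j \<in> borel_measurable M" using X J by auto
  have "prob {w\<in>space M. \<forall>j\<in>J. X j w \<in> B j} = (\<Prod>j\<in>J. measure (distr M borel (X j)) (B j))"
    by (rule char_factor_prob)
       (use J Xm B char[OF J(3,2)] prob_space_axioms in
        \<open>auto intro!: real_distribution_distr prod.cong simp: char_def integral_distr\<close>)
  also have "\<dots> = (\<Prod>j\<in>J. prob (A j))"
    using B Xm by (intro prod.cong) (auto simp: measure_distr)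
  also have "{w\<in>space M. \<forall>j\<in>J. X j w \<in> B j} = (\<Inter>j\<in>J. A j)"
    using J B by auto
  finally show "prob (\<Inter>j\<in>J. A j) = (\<Prod>j\<in>J. prob (A j))" .
next
  fix i assume "i \<in> I"
  then show "{X i -` A \<inter> space M |A. A \<in> sets borel} \<subseteq> events"
    using X by (auto intro: measurable_sets)
qed (use X in auto)

section \<open>Densities by Fourier inversion\<close>

text \<open>A second-order Taylor bound on the integrand survives integration, so derivatives of
  Fourier integrals and of distribution functions follow without interchanging a limit and an
  integral. The price is one additional moment.\<close>

lemma DERIV_if_quadratic_bound:
  fixes F :: "real \<Rightarrow> real"
  assumes "\<And>h. \<bar>F (x + h) - F x - h * D\<bar> \<le> K * h\<^sup>2"
  shows "DERIV F x :> D"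
  unfolding DERIV_def
proof (rule LIM_zero_cancel, rule Lim_null_comparison)
  show "\<forall>\<^sub>F h in at 0. norm ((F (x + h) - F x) / h - D) \<le> K * \<bar>h\<bar>"
  proof (rule eventually_mono[OF eventually_neq_at_within[of 0]])
    fix h :: real assume h: "h \<noteq> 0"
    have "norm ((F (x + h) - F x) / h - D) = \<bar>F (x + h) - F x - h * D\<bar> / \<bar>h\<bar>"
      using h by (simp add: field_simps flip: abs_divide)
    also have "\<dots> \<le> K * h\<^sup>2 / \<bar>h\<bar>"
      using assms by (intro divide_right_mono) auto
    also have "\<dots> = K * \<bar>h\<bar>"
      using h by (simp add: power2_eq_square abs_if)
    finally show "norm ((F (x + h) - F x) / h - D) \<le> K * \<bar>h\<bar>" .
  qed
  show "((\<lambda>h. K * \<bar>h\<bar>) \<longlongrightarrow> 0) (at 0)"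
    by (auto intro!: tendsto_eq_intros)
qed

text \<open>The factor \<open>(- (\<i> * t)) ^ k\<close> is what \<open>k\<close> differentiations
  of \<open>iexp (- (t * x))\<close> produce, so differentiation just raises \<open>k\<close>. The
  real part yields a real-valued function without any symmetry assumption on
  \<open>g\<close>.\<close>

definition fourier_inverse :: "(real \<Rightarrow> complex) \<Rightarrow> nat \<Rightarrow> real \<Rightarrow> real" where
  "fourier_inverse g k x = Re (CLINT t|lborel. (- (\<i> * t)) ^ k * iexp (- (t * x)) * g t) / (2 * pi)"

lemma iexp_diff_bound: "norm (iexp x - 1) \<le> \<bar>x\<bar>"
  using iexp_approx1[of x 0] by simp

lemma iexp_linear_bound: "norm (iexp x - 1 - \<i> * x) \<le> x\<^sup>2 / 2"
  using iexp_approx1[of x 1] by (simp add: power2_eq_square algebra_simps)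

context
  fixes g :: "real \<Rightarrow> complex"
  assumes g [measurable]: "g \<in> borel_measurable borel"
begin

lemma integrable_fourier_integrand:
  assumes "integrable lborel (\<lambda>t. t ^ k *\<^sub>R g t)"
  shows "integrable lborel (\<lambda>t. (- (\<i> * t)) ^ k * iexp (- (t * x)) * g t)"
  by (rule Bochner_Integration.integrable_bound[OF assms])
     (auto simp: norm_mult norm_power power_abs)

lemma abs_fourier_inverse_le:
  assumes "integrable lborel (\<lambda>t. t ^ k *\<^sub>R g t)"
  shows "\<bar>fourier_inverse g k x\<bar> \<le> (LINT t|lborel. norm (t ^ k *\<^sub>R g t)) / (2 * pi)"
proof -
  have "\<bar>Re (CLINT t|lborel. (- (\<i> * t)) ^ k * iexp (- (t * x)) * g t)\<bar> \<le>
     norm (CLINT t|lborel. (- (\<i> * t)) ^ k * iexp (- (t * x)) * g t)"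
    by (rule abs_Re_le_cmod)
  also have "\<dots> \<le> (LINT t|lborel. norm ((- (\<i> * t)) ^ k * iexp (- (t * x)) * g t))"
    by (rule integral_norm_bound)
  also have "\<dots> = (LINT t|lborel. norm (t ^ k *\<^sub>R g t))"
    by (intro Bochner_Integration.integral_cong) (auto simp: norm_mult norm_power power_abs)
  finally show ?thesis
    unfolding fourier_inverse_def by (simp add: abs_divide divide_right_mono)
qed

text \<open>The bound \<open>|exp (ix) - 1| <= |x|\<close> trades the increment \<open>y - x\<close>
  for one further power of \<open>t\<close>.\<close>

lemma fourier_inverse_lipschitz:
  assumes k: "integrable lborel (\<lambda>t. t ^ k *\<^sub>R g t)" and k1: "integrable lborel (\<lambda>t. t ^ Suc k *\<^sub>R g t)"
  shows "\<bar>fourier_inverse g k y - fourier_inverse g k x\<bar> \<le>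
    (LINT t|lborel. norm (t ^ Suc k *\<^sub>R g t)) / (2 * pi) * \<bar>y - x\<bar>"
proof -
  let ?I = "\<lambda>x t. (- (\<i> * t)) ^ k * iexp (- (t * x)) * g t"
  note int = integrable_fourier_integrand[OF k]
  have bound: "norm (?I y t - ?I x t) \<le> norm (t ^ Suc k *\<^sub>R g t) * \<bar>y - x\<bar>" for t
  proof -
    have "?I y t - ?I x t = (- (\<i> * t)) ^ k * iexp (- (t * x)) * g t * (iexp (- (t * (y - x))) - 1)"
      by (simp add: algebra_simps flip: exp_add)
    then have "norm (?I y t - ?I x t) = \<bar>t\<bar> ^ k * norm (g t) * norm (iexp (- (t * (y - x))) - 1)"
      by (simp add: norm_mult norm_power)
    also have "\<dots> \<le> \<bar>t\<bar> ^ k * norm (g t) * \<bar>- (t * (y - x))\<bar>"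
      by (intro mult_left_mono iexp_diff_bound) auto
    finally show ?thesis by (simp add: abs_mult power_abs mult_ac)
  qed
  have "\<bar>fourier_inverse g k y - fourier_inverse g k x\<bar> = \<bar>Re (CLINT t|lborel. ?I y t - ?I x t)\<bar> / (2 * pi)"
    unfolding fourier_inverse_def using int[of y] int[of x]
    by (simp add: abs_divide flip: diff_divide_distrib)
  also have "\<dots> \<le> norm (CLINT t|lborel. ?I y t - ?I x t) / (2 * pi)"
    by (intro divide_right_mono abs_Re_le_cmod) auto
  also have "\<dots> \<le> (LINT t|lborel. norm (?I y t - ?I x t)) / (2 * pi)"
    by (intro divide_right_mono integral_norm_bound) auto
  also have "\<dots> \<le> (LINT t|lborel. norm (t ^ Suc k *\<^sub>R g t) * \<bar>y - x\<bar>) / (2 * pi)"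
    by (intro divide_right_mono integral_mono integrable_mult_left integrable_norm k1 bound
          Bochner_Integration.integrable_diff int) auto
  finally show ?thesis by simp
qed

lemma DERIV_fourier_inverse:
  assumes k: "integrable lborel (\<lambda>t. t ^ k *\<^sub>R g t)" and k1: "integrable lborel (\<lambda>t. t ^ Suc k *\<^sub>R g t)"
    and k2: "integrable lborel (\<lambda>t. t ^ Suc (Suc k) *\<^sub>R g t)"
  shows "DERIV (fourier_inverse g k) x :> fourier_inverse g (Suc k) x"
proof (rule DERIV_if_quadratic_bound)
  fix h :: real
  let ?I = "\<lambda>k x t. (- (\<i> * t)) ^ k * iexp (- (t * x)) * g t"
  let ?K = "(LINT t|lborel. norm (t ^ Suc (Suc k) *\<^sub>R g t)) / (4 * pi)"
  note int = integrable_fourier_integrand[OF k] integrable_fourier_integrand[OF k1]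
  let ?D = "\<lambda>t. ?I k (x + h) t - ?I k x t - h *\<^sub>R ?I (Suc k) x t"
  have bound: "norm (?D t) \<le> norm (t ^ Suc (Suc k) *\<^sub>R g t) * (h\<^sup>2 / 2)" for t
  proof -
    have "?D t = (- (\<i> * t)) ^ k * iexp (- (t * x)) * g t * (iexp (- (t * h)) - 1 - \<i> * of_real (- (t * h)))"
      by (simp add: algebra_simps scaleR_conv_of_real flip: exp_add)
    then have "norm (?D t) = \<bar>t\<bar> ^ k * norm (g t) * norm (iexp (- (t * h)) - 1 - \<i> * of_real (- (t * h)))"
      by (simp add: norm_mult norm_power del: of_real_minus of_real_mult)
    also have "\<dots> \<le> \<bar>t\<bar> ^ k * norm (g t) * ((- (t * h))\<^sup>2 / 2)"
      by (intro mult_left_mono iexp_linear_bound) auto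
    also have "\<dots> = norm (t ^ Suc (Suc k) *\<^sub>R g t) * (h\<^sup>2 / 2)"
      by (simp add: abs_mult power_abs mult_ac power2_eq_square)
    finally show ?thesis .
  qed
  have iD: "integrable lborel ?D"
    by (intro Bochner_Integration.integrable_diff integrable_scaleR_right int)
  have "\<bar>fourier_inverse g k (x + h) - fourier_inverse g k x - h * fourier_inverse g (Suc k) x\<bar> =
      \<bar>Re (CLINT t|lborel. ?D t)\<bar> / (2 * pi)"
  proof -
    have "(CLINT t|lborel. ?D t) = (CLINT t|lborel. ?I k (x+h) t) - (CLINT t|lborel. ?I k x t) - h *\<^sub>R (CLINT t|lborel. ?I (Suc k) x t)"
      by (intro Bochner_Integration.integral_diff[THEN trans] arg_cong2[of _ _ _ _ "(-)"] integral_scaleR_right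
            Bochner_Integration.integrable_diff integrable_scaleR_right int refl)
    then show ?thesis
      unfolding fourier_inverse_def by (simp add: abs_divide del: power_Suc flip: diff_divide_distrib)
  qed
  also have "\<dots> \<le> norm (CLINT t|lborel. ?D t) / (2 * pi)"
    by (intro divide_right_mono abs_Re_le_cmod) auto
  also have "\<dots> \<le> (LINT t|lborel. norm (?D t)) / (2 * pi)"
    by (intro divide_right_mono integral_norm_bound) auto
  also have "\<dots> \<le> (LINT t|lborel. norm (t ^ Suc (Suc k) *\<^sub>R g t) * (h\<^sup>2 / 2)) / (2 * pi)"
    by (intro divide_right_mono integral_mono integrable_mult_left integrable_norm k2 bound iD) auto
  also have "\<dots> = ?K * h\<^sup>2" by simp
  finally show "\<bar>fourier_inverse g k (x + h) - fourier_inverse g k x - h * fourier_inverse g (Suc k) x\<bar> \<le> ?K * h\<^sup>2" .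
qed

text \<open>Moments up to \<open>Suc m\<close> are what both uses cost:
  \<open>DERIV_fourier_inverse\<close> at \<open>k < m\<close> takes orders up to
  \<open>k + 2\<close>, and the Lipschitz bound that makes the derivative of order \<open>m\<close>
  continuous takes order \<open>m + 1\<close>.\<close>

lemma deriv_fourier_inverse:
  assumes int: "\<And>k. k \<le> Suc m \<Longrightarrow> integrable lborel (\<lambda>t. t ^ k *\<^sub>R g t)"
  shows "k \<le> m \<Longrightarrow> (deriv ^^ k) (fourier_inverse g 0) = fourier_inverse g k"
    and "k < m \<Longrightarrow> fourier_inverse g k differentiable at x"
    and "k \<le> m \<Longrightarrow> continuous_on UNIV (fourier_inverse g k)"
proof -
  have D: "DERIV (fourier_inverse g k) x :> fourier_inverse g (Suc k) x" if "k < m" for k x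
    using that by (intro DERIV_fourier_inverse int) auto
  show "k \<le> m \<Longrightarrow> (deriv ^^ k) (fourier_inverse g 0) = fourier_inverse g k"
  proof (induction k)
    case (Suc k)
    then show ?case using DERIV_imp_deriv[OF D[of k]] by auto
  qed simp
  show "k < m \<Longrightarrow> fourier_inverse g k differentiable at x"
    using D real_differentiable_def by blast
  show "continuous_on UNIV (fourier_inverse g k)" if "k \<le> m"
  proof -
    define L where "L = (LINT t|lborel. norm (t ^ Suc k *\<^sub>R g t)) / (2 * pi)"
    have "L-lipschitz_on UNIV (fourier_inverse g k)"
    proof (rule lipschitz_onI)
      show "0 \<le> L" by (simp add: L_def)
      show "dist (fourier_inverse g k x) (fourier_inverse g k y) \<le> L * dist x y" for x y
        unfolding L_def dist_real_def using that by (intro fourier_inverse_lipschitz int) auto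
    qed
    then show ?thesis by (rule lipschitz_on_continuous_on)
  qed
qed

end

section \<open>From Levy inversion to a continuous density\<close>

text \<open>
  Levy inversion excludes intervals whose end points are atoms. Shifting both end points to the right
  by the same amount avoids the atoms, and right continuity of the distribution function gives the rest.
\<close>

lemma (in real_distribution) cdf_increment_bound:
  assumes int: "integrable lborel (char M)" "integrable lborel (\<lambda>t. t *\<^sub>R char M t)" and d: "d \<ge> 0"
  shows "\<bar>cdf M (a + d) - cdf M a - d * fourier_inverse (char M) 0 a\<bar> \<le>
    (LINT t|lborel. norm (t *\<^sub>R char M t)) / (4 * pi) * d\<^sup>2"
proof -
  define f where "f = fourier_inverse (char M) 0"
  define K where "K = (LINT t|lborel. norm (t *\<^sub>R char M t)) / (4 * pi)"
  have int0: "integrable lborel (\<lambda>t. t ^ 0 *\<^sub>R char M t)" "integrable lborel (\<lambda>t. t ^ Suc 0 *\<^sub>R char M t)"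
    using int by auto
  have nonatom: "\<bar>cdf M (a + d) - cdf M a - d * f a\<bar> \<le> K * d\<^sup>2"
    if at: "measure M {a} = 0" "measure M {a + d} = 0" for a
  proof -
    define D where "D = (\<lambda>t. (iexp (-(t * a)) - iexp (-(t * (a + d)))) / (\<i> * t) * char M t)"
    have Dm [measurable]: "D \<in> borel_measurable borel" unfolding D_def by measurable
    have Dd: "D t = iexp (-(t * a)) * char M t * (1 - iexp (-(t * d))) / (\<i> * t)" for t
      by (simp add: D_def algebra_simps flip: exp_add)
    have Db: "norm (D t) \<le> d * norm (char M t)" for t
    \<comment> \<open>The singularity of the Levy kernel at 0 is removable, since
      \<open>|1 - exp (-itd)| <= |t| d\<close>. At \<open>t = 0\<close> itself division by zero
      makes \<open>D\<close> vanish.\<close>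
    proof (cases "t = 0")
      case False
      have "norm (1 - iexp (-(t * d))) \<le> \<bar>t\<bar> * d"
        using iexp_diff_bound[of "-(t*d)"] d by (simp add: norm_minus_commute abs_mult)
      then have "norm (char M t) * norm (1 - iexp (-(t * d))) / \<bar>t\<bar> \<le> norm (char M t) * (\<bar>t\<bar> * d) / \<bar>t\<bar>"
        by (intro divide_right_mono mult_left_mono) auto
      with False show ?thesis by (simp add: Dd norm_mult norm_divide mult_ac)
    qed (use d in \<open>simp add: Dd\<close>)
    have Di: "integrable lborel D"
      by (rule Bochner_Integration.integrable_bound[OF integrable_mult_right[OF integrable_norm[OF int(1)], of d]])
         (use Db d in \<open>auto simp: abs_mult\<close>)
    have "(\<lambda>T. 1 / (2 * pi) * (CLBINT t=-real T..real T. D t)) \<longlonglongrightarrow> measure M {a<..a+d}"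
      using Levy_Inversion[of a "a+d"] at d unfolding D_def by simp
    \<comment> \<open>As \<open>D\<close> is integrable, the symmetric limit in Levy's formula is an
      ordinary Lebesgue integral.\<close>
    moreover have "(\<lambda>T. CLBINT t=-real T..real T. D t) \<longlonglongrightarrow> (CLINT t|lborel. D t)"
    proof -
      have "(\<lambda>T::nat. CLINT t|lborel. indicator {-real T..real T} t *\<^sub>R D t) \<longlonglongrightarrow> (CLINT t|lborel. D t)"
      proof (rule integral_dominated_convergence[where w="\<lambda>t. norm (D t)"])
        show "AE x in lborel. (\<lambda>i. indicator {-real i..real i} x *\<^sub>R D x) \<longlonglongrightarrow> D x"
        proof (rule AE_I2)
          fix x :: real
          obtain n where n: "\<bar>x\<bar> \<le> real n" using real_arch_simple by blast
          have "\<forall>\<^sub>F i in sequentially. D x = indicator {-real i..real i} x *\<^sub>R D x"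
            using eventually_ge_at_top[of n]
          proof eventually_elim
            case (elim i)
            with n have "x \<in> {-real i..real i}" by auto
            then show ?case by simp
          qed
          then show "(\<lambda>i. indicator {-real i..real i} x *\<^sub>R D x) \<longlonglongrightarrow> D x"
            by (rule Lim_transform_eventually[OF tendsto_const])
        qed
      qed (use Di in \<open>auto simp: indicator_def\<close>)
      then show ?thesis
        by (simp add: interval_integral_Icc set_lebesgue_integral_def)
    qed
    then have "(\<lambda>T. 1 / (2 * pi) * (CLBINT t=-real T..real T. D t)) \<longlonglongrightarrow> 1 / (2 * pi) * (CLINT t|lborel. D t)"
      by (intro tendsto_intros)
    ultimately have "complex_of_real (measure M {a<..a+d}) = 1 / (2 * pi) * (CLINT t|lborel. D t)"
      by (rule LIMSEQ_unique)
    then have "Re (complex_of_real (measure M {a<..a+d})) = Re ((1 / (2 * pi)) *\<^sub>R (CLINT t|lborel. D t))"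
      by (simp add: scaleR_conv_of_real)
    then have mu: "measure M {a<..a+d} = Re (CLINT t|lborel. D t) / (2 * pi)" by simp
    have cdf: "cdf M (a + d) - cdf M a = measure M {a<..a+d}"
      using d by (cases "d = 0") (auto simp: cdf_diff_eq)
    define I where "I = (\<lambda>t. (- (\<i> * t)) ^ 0 * iexp (- (t * a)) * char M t)"
    have Ii: "integrable lborel I"
      unfolding I_def by (rule integrable_fourier_integrand[OF _ int0(1)]) measurable
    \<comment> \<open>The point \<open>t = 0\<close> has to be left out: there \<open>D\<close>
      takes the value 0 while \<open>d *\<^sub>R I t\<close> equals \<open>d\<close>. It is a null
      set, so an almost everywhere bound suffices below.\<close>
    have bound: "norm (D t - d *\<^sub>R I t) \<le> norm (t *\<^sub>R char M t) * (d\<^sup>2 / 2)" if t: "t \<noteq> 0" for t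
    proof -
      have "D t - d *\<^sub>R I t = - (iexp (-(t * a)) * char M t * (iexp (-(t * d)) - 1 - \<i> * of_real (-(t * d))) / (\<i> * t))"
        using t unfolding Dd I_def by (simp add: scaleR_conv_of_real field_simps)
      then have "norm (D t - d *\<^sub>R I t) = norm (char M t) * norm (iexp (-(t * d)) - 1 - \<i> * of_real (-(t * d))) / \<bar>t\<bar>"
        by (simp add: norm_mult norm_divide del: of_real_minus of_real_mult)
      also have "\<dots> \<le> norm (char M t) * ((-(t * d))\<^sup>2 / 2) / \<bar>t\<bar>"
        by (intro divide_right_mono mult_left_mono iexp_linear_bound) auto
      also have "\<dots> = norm (t *\<^sub>R char M t) * (d\<^sup>2 / 2)"
        using t by (simp add: power2_eq_square field_simps abs_if)
      finally show ?thesis .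
    qed
    have iDI: "integrable lborel (\<lambda>t. D t - d *\<^sub>R I t)" using Di Ii by auto
    have "\<bar>cdf M (a + d) - cdf M a - d * f a\<bar> = \<bar>Re (CLINT t|lborel. D t - d *\<^sub>R I t)\<bar> / (2 * pi)"
      unfolding cdf mu f_def fourier_inverse_def I_def[symmetric] using Di Ii
      by (simp add: abs_divide flip: diff_divide_distrib)
    also have "\<dots> \<le> norm (CLINT t|lborel. D t - d *\<^sub>R I t) / (2 * pi)"
      by (intro divide_right_mono abs_Re_le_cmod) auto
    also have "\<dots> \<le> (LINT t|lborel. norm (D t - d *\<^sub>R I t)) / (2 * pi)"
      by (intro divide_right_mono integral_norm_bound) auto
    also have "\<dots> \<le> (LINT t|lborel. norm (t *\<^sub>R char M t) * (d\<^sup>2 / 2)) / (2 * pi)"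
    proof (intro divide_right_mono integral_mono_AE)
      show "AE t in lborel. norm (D t - d *\<^sub>R I t) \<le> norm (t *\<^sub>R char M t) * (d\<^sup>2 / 2)"
        using AE_lborel_singleton[of 0] by eventually_elim (rule bound)
    qed (use iDI int in \<open>auto simp del: norm_scaleR times_divide_eq_right intro!: integrable_norm integrable_mult_left\<close>)
    also have "\<dots> = K * d\<^sup>2" by (simp add: K_def)
    finally show ?thesis .
  qed
  define A where "A = {x. measure M {x} \<noteq> 0} \<union> (\<lambda>x. x - d) ` {x. measure M {x} \<noteq> 0}"
  have "countable A" unfolding A_def by (intro countable_Un countable_image countable_support)
  then have "\<exists>x\<in>{a<..<a + 1 / Suc n}. x \<notin> A" for n
    by (rule open_minus_countable) auto
  then obtain x where x: "\<And>n. a < x n" "\<And>n. x n < a + 1 / Suc n" "\<And>n. x n \<notin> A"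
    by (metis greaterThanLessThan_iff)
  have at: "measure M {x n} = 0" "measure M {x n + d} = 0" for n
    using x(3)[of n] by (auto simp: A_def image_iff)
  have lim: "x \<longlonglongrightarrow> a"
  proof (rule tendsto_sandwich[of "\<lambda>_. a" _ _ "\<lambda>n. a + 1 / Suc n"])
    show "(\<lambda>n. a + 1 / real (Suc n)) \<longlonglongrightarrow> a"
      using tendsto_add[OF tendsto_const[of a] LIMSEQ_Suc[OF lim_1_over_n]] by simp
  qed (use x in \<open>auto intro!: always_eventually less_imp_le\<close>)
  have cdf_lim: "(\<lambda>n. cdf M (x n + c)) \<longlonglongrightarrow> cdf M (a + c)" for c
  proof -
    have "filterlim (\<lambda>n. x n + c) (at_right (a + c)) sequentially"
      unfolding filterlim_at using x(1) x(1)[THEN less_imp_neq]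
      by (intro conjI tendsto_intros lim always_eventually) auto
    then show ?thesis
      using cdf_is_right_cont[of "a + c"] unfolding continuous_within by (rule filterlim_compose[rotated])
  qed
  have "continuous_on UNIV f"
    unfolding f_def
    by (rule deriv_fourier_inverse(3)[where m=0])
       (use int in \<open>auto simp: le_Suc_eq\<close>)
  then have f_lim: "(\<lambda>n. f (x n)) \<longlonglongrightarrow> f a"
    using lim by (rule continuous_on_tendsto_compose) auto
  have "(\<lambda>n. \<bar>cdf M (x n + d) - cdf M (x n + 0) - d * f (x n)\<bar>) \<longlonglongrightarrow> \<bar>cdf M (a + d) - cdf M (a + 0) - d * f a\<bar>"
    by (intro tendsto_intros cdf_lim f_lim)
  then have "\<bar>cdf M (a + d) - cdf M (a + 0) - d * f a\<bar> \<le> K * d\<^sup>2"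
    by (rule LIMSEQ_le_const2) (use nonatom[OF at] in auto)
  then show ?thesis by (simp add: f_def K_def)
qed

text \<open>For negative \<open>h\<close> the increment estimate is applied from the left end point
  \<open>x + h\<close>, which produces the density at \<open>x + h\<close> instead of
  \<open>x\<close>. The Lipschitz constant \<open>?L\<close> pays for moving it to
  \<open>x\<close>.\<close>

lemma (in real_distribution) DERIV_cdf_fourier_inverse:
  assumes int: "integrable lborel (char M)" "integrable lborel (\<lambda>t. t *\<^sub>R char M t)"
  shows "DERIV (cdf M) x :> fourier_inverse (char M) 0 x"
proof (rule DERIV_if_quadratic_bound)
  fix h :: real
  let ?f = "fourier_inverse (char M) 0"
  let ?I = "LINT t|lborel. norm (t *\<^sub>R char M t)"
  let ?K = "?I / (4 * pi)" and ?L = "?I / (2 * pi)"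
  have L: "?L \<ge> 0" by simp
  show "\<bar>cdf M (x + h) - cdf M x - h * ?f x\<bar> \<le> (?K + ?L) * h\<^sup>2"
  proof (cases "h \<ge> 0")
    case True
    then have "\<bar>cdf M (x + h) - cdf M x - h * ?f x\<bar> \<le> ?K * h\<^sup>2"
      by (rule cdf_increment_bound[OF int])
    also have "\<dots> \<le> (?K + ?L) * h\<^sup>2"
      by (rule mult_right_mono[OF le_add_same_cancel1[THEN iffD2, OF L]]) simp
    finally show ?thesis .
  next
    case False
    have 1: "\<bar>cdf M (x + h + (-h)) - cdf M (x + h) - (-h) * ?f (x + h)\<bar> \<le> ?K * (-h)\<^sup>2"
      using False by (intro cdf_increment_bound[OF int]) auto
    have "\<bar>?f (x + h) - ?f x\<bar> \<le> ?L * \<bar>x + h - x\<bar>"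
      using fourier_inverse_lipschitz[of "char M" 0 "x + h" x] int by auto
    then have "\<bar>h\<bar> * \<bar>?f (x + h) - ?f x\<bar> \<le> \<bar>h\<bar> * (?L * \<bar>x + h - x\<bar>)"
      by (intro mult_left_mono) auto
    then have 2: "\<bar>h * (?f (x + h) - ?f x)\<bar> \<le> ?L * h\<^sup>2"
      by (simp add: abs_mult power2_eq_square mult_ac)
    have "cdf M (x + h) - cdf M x - h * ?f x =
      h * (?f (x + h) - ?f x) - (cdf M (x + h + (-h)) - cdf M (x + h) - (-h) * ?f (x + h))"
      by (simp add: algebra_simps)
    then have "\<bar>cdf M (x + h) - cdf M x - h * ?f x\<bar> \<le> ?L * h\<^sup>2 + ?K * (-h)\<^sup>2"
      using 1 2 by linarith
    then show ?thesis by (simp add: algebra_simps)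
  qed
qed

text \<open>Nonnegativity holds because the function is the derivative of a monotone distribution
  function; integrating it back over half-lines identifies it as the density.\<close>

lemma (in prob_space) distributed_fourier_inverse:
  fixes X :: "'a \<Rightarrow> real"
  assumes [measurable]: "X \<in> borel_measurable M"
    and int: "integrable lborel (char (distr M borel X))"
      "integrable lborel (\<lambda>t. t *\<^sub>R char (distr M borel X) t)"
  defines "f \<equiv> fourier_inverse (char (distr M borel X)) 0"
  shows "0 \<le> f x" and "distributed M lborel X (\<lambda>x. ennreal (f x))"
proof -
  let ?D = "distr M borel X"
  interpret D: real_distribution ?D by (rule real_distribution_distr) simp
  have D: "DERIV (cdf ?D) x :> f x" for x
    unfolding f_def by (rule D.DERIV_cdf_fourier_inverse[OF int])
  show f0: "0 \<le> f x" for x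
    by (rule mono_on_imp_deriv_nonneg[of UNIV "cdf ?D"])
       (use D in \<open>auto intro!: mono_onI D.cdf_nondecreasing\<close>)
  have "continuous_on UNIV f"
    unfolding f_def by (rule deriv_fourier_inverse(3)[where m=0]) (use int in \<open>auto simp: le_Suc_eq\<close>)
  then have fm [measurable]: "f \<in> borel_measurable borel"
    by (rule borel_measurable_continuous_onI)
  show "distributed M lborel X (\<lambda>x. ennreal (f x))"
  proof (rule distributedI_borel_atMost[where g="cdf ?D"])
    fix a :: real
    \<comment> \<open>The reflection \<open>x\<close> to \<open>-x\<close> turns the half-line into
      one unbounded above, where the antiderivative \<open>- cdf ?D (- x)\<close> tends to
      0.\<close>
    have "(\<integral>\<^sup>+x. ennreal (f x) * indicator {..a} x \<partial>lborel) =
        (\<integral>\<^sup>+x. ennreal (f (- x)) * indicator {-a..} x \<partial>lborel)"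
      by (subst nn_integral_real_affine[where c="-1" and t=0])
         (auto intro!: nn_integral_cong simp: indicator_def)
    also have "\<dots> = ennreal (0 - (- cdf ?D (- (- a))))"
    proof (rule nn_integral_FTC_atLeast)
      show "DERIV (\<lambda>x. - cdf ?D (- x)) x :> f (- x)" for x
        by (auto intro!: derivative_eq_intros DERIV_chain2[OF D])
      have "((\<lambda>x. - cdf ?D (- x)) \<longlongrightarrow> - 0) at_top"
        by (intro tendsto_minus filterlim_compose[OF D.cdf_lim_at_bot] filterlim_uminus_at_bot_at_top)
      then show "((\<lambda>x. - cdf ?D (- x)) \<longlongrightarrow> 0) at_top" by simp
    qed (use f0 in auto)
    also have "(\<integral>\<^sup>+x. ennreal (f x) * indicator {..a} x \<partial>lborel) =
        (\<integral>\<^sup>+x. ennreal (f x * indicator {..a} x) \<partial>lborel)"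
      by (intro nn_integral_cong) (auto simp: indicator_def)
    finally show "(\<integral>\<^sup>+x. ennreal (f x * indicator {..a} x) \<partial>lborel) = ennreal (cdf ?D a)" by simp
    show "emeasure M {x \<in> space M. X x \<le> a} = ennreal (cdf ?D a)"
      by (auto simp: cdf_def measure_distr emeasure_eq_measure vimage_def Int_def conj_commute)
  qed (use f0 in auto)
qed

section \<open>The Gaussian density and decay estimates\<close>

lemma std_normal_integral_lborel:
  fixes f :: "real \<Rightarrow> complex"
  assumes [measurable]: "f \<in> borel_measurable borel"
  shows "(CLINT x|std_normal_distribution. f x) = (CLINT x|lborel. std_normal_density x *\<^sub>R f x)"
  by (subst integral_density) auto

lemma std_normal_char_lborel:
  "(CLINT x|lborel. std_normal_density x *\<^sub>R iexp (t * x)) = exp (- (t\<^sup>2) / 2)"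
  using fun_cong[OF char_std_normal_distribution, of t]
  by (simp add: char_def std_normal_integral_lborel exp_of_real)

text \<open>The substitution \<open>t = u / \<sigma>\<close> turns the Gaussian factor into a
  multiple of the standard density, whose Fourier transform is known. This puts the comparison
  density in the same form as that of \<open>F\<close>, so that one estimate covers both.\<close>

lemma normal_density_eq_fourier_inverse:
  assumes \<sigma>: "\<sigma> > 0"
  shows "normal_density 0 \<sigma> = fourier_inverse (\<lambda>t. of_real (exp (- (\<sigma>\<^sup>2 * t\<^sup>2) / 2))) 0"
proof
  fix x
  have "(CLINT t|lborel. iexp (- (t * x)) * of_real (exp (- (\<sigma>\<^sup>2 * t\<^sup>2) / 2))) =
      (1 / \<sigma>) *\<^sub>R (CLINT u|lborel. iexp (- (u / \<sigma> * x)) * of_real (exp (- (\<sigma>\<^sup>2 * (u / \<sigma>)\<^sup>2) / 2)))"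
    using \<sigma> by (subst lborel_integral_real_affine[where c="1 / \<sigma>" and t=0]) (auto simp: mult_ac)
  also have "(CLINT u|lborel. iexp (- (u / \<sigma> * x)) * of_real (exp (- (\<sigma>\<^sup>2 * (u / \<sigma>)\<^sup>2) / 2))) =
      (CLINT u|lborel. sqrt (2 * pi) *\<^sub>R (std_normal_density u *\<^sub>R iexp ((- x / \<sigma>) * u)))"
  proof (intro Bochner_Integration.integral_cong refl)
    fix u
    have "\<sigma>\<^sup>2 * (u / \<sigma>)\<^sup>2 = u\<^sup>2" using \<sigma> by (simp add: power_divide)
    then have 1: "exp (- (\<sigma>\<^sup>2 * (u / \<sigma>)\<^sup>2) / 2) = sqrt (2 * pi) * std_normal_density u"
      by (simp add: std_normal_density_def)
    have 2: "- (u / \<sigma> * x) = (- x / \<sigma>) * u" by simp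
    show "iexp (- (u / \<sigma> * x)) * of_real (exp (- (\<sigma>\<^sup>2 * (u / \<sigma>)\<^sup>2) / 2)) =
      sqrt (2 * pi) *\<^sub>R (std_normal_density u *\<^sub>R iexp ((- x / \<sigma>) * u))"
      unfolding 1 2 by (simp only: scaleR_conv_of_real of_real_mult mult_ac)
  qed
  also have "\<dots> = sqrt (2 * pi) *\<^sub>R complex_of_real (exp (- ((- x / \<sigma>)\<^sup>2) / 2))"
    unfolding integral_scaleR_right std_normal_char_lborel ..
  also have "(1 / \<sigma>) *\<^sub>R \<dots> = complex_of_real (1 / \<sigma> * sqrt (2 * pi) * exp (- ((- x / \<sigma>)\<^sup>2) / 2))"
    by (simp add: scaleR_conv_of_real)
  finally have I: "(CLINT t|lborel. iexp (- (t * x)) * of_real (exp (- (\<sigma>\<^sup>2 * t\<^sup>2) / 2))) =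
      complex_of_real (1 / \<sigma> * sqrt (2 * pi) * exp (- ((- x / \<sigma>)\<^sup>2) / 2))" .
  have "fourier_inverse (\<lambda>t. of_real (exp (- (\<sigma>\<^sup>2 * t\<^sup>2) / 2))) 0 x =
      1 / \<sigma> * sqrt (2 * pi) * exp (- ((- x / \<sigma>)\<^sup>2) / 2) / (2 * pi)"
    unfolding fourier_inverse_def power_0 mult_1 I Re_complex_of_real ..
  also have "\<dots> = normal_density 0 \<sigma> x"
  proof -
    define r where "r = sqrt (2 * pi)"
    have r: "r > 0" "2 * pi = r * r" by (simp_all add: r_def)
    have "sqrt (2 * pi * \<sigma>\<^sup>2) = \<sigma> * r"
      using \<sigma> by (simp add: real_sqrt_mult r_def)
    then show ?thesis
      unfolding normal_density_def r_def[symmetric] using r \<sigma>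
      by (simp add: power_divide r(2))
  qed
  finally show "normal_density 0 \<sigma> x = fourier_inverse (\<lambda>t. of_real (exp (- (\<sigma>\<^sup>2 * t\<^sup>2) / 2))) 0 x" ..
qed

text \<open>With \<open>c = min 1 (4 * l^2)\<close> one has
  \<open>c * (1 + t^2) <= 1 + 4 * l^2 * t^2\<close>, and
  \<open>|t|^k <= (1 + t^2) powr (k/2)\<close>. The total exponent \<open>k/2 - N/4\<close> of
  \<open>1 + t^2\<close> is at most -1 precisely when \<open>2 * k + 4 <= N\<close>; the integral of
  \<open>1/(1 + t^2)\<close> gives the factor \<open>pi\<close>.\<close>

lemma moment_decay:
  fixes g :: "real \<Rightarrow> complex"
  assumes [measurable]: "g \<in> borel_measurable borel"
    and g: "\<And>t. norm (g t) \<le> ((1 + 4 * l\<^sup>2 * t\<^sup>2) powr (-1/4)) ^ N"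
    and l: "l \<noteq> 0" and k: "2 * k + 4 \<le> N"
  shows "integrable lborel (\<lambda>t. t ^ k *\<^sub>R g t)"
    and "(LINT t|lborel. norm (t ^ k *\<^sub>R g t)) \<le> min 1 (4 * l\<^sup>2) powr (- (N / 4)) * pi"
proof -
  define c where "c = min 1 (4 * l\<^sup>2)"
  define K where "K = c powr (- (N / 4))"
  have c: "c > 0" using l by (simp add: c_def)
  have bound: "norm (t ^ k *\<^sub>R g t) \<le> K * inverse (1 + t\<^sup>2)" for t
  proof -
    have t1: "1 + t\<^sup>2 \<ge> 1" by simp
    have "c * (1 + t\<^sup>2) = c + c * t\<^sup>2" by (simp add: algebra_simps)
    also have "\<dots> \<le> 1 + 4 * l\<^sup>2 * t\<^sup>2"
      by (intro add_mono mult_right_mono) (auto simp: c_def)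
    finally have "(1 + 4 * l\<^sup>2 * t\<^sup>2) powr (-1/4) \<le> (c * (1 + t\<^sup>2)) powr (-1/4)"
      using c by (intro powr_mono2') (auto intro!: mult_pos_pos add_pos_nonneg)
    then have "((1 + 4 * l\<^sup>2 * t\<^sup>2) powr (-1/4)) ^ N \<le> ((c * (1 + t\<^sup>2)) powr (-1/4)) ^ N"
      by (intro power_mono) auto
    also have "\<dots> = (c * (1 + t\<^sup>2)) powr (- (N / 4))"
    proof -
      have "0 < c * (1 + t\<^sup>2)" using c by (intro mult_pos_pos add_pos_nonneg) auto
      then have "0 < (c * (1 + t\<^sup>2)) powr (-1/4)" unfolding powr_gt_zero by linarith
      then show ?thesis by (simp add: powr_powr flip: powr_realpow)
    qed
    also have "\<dots> = K * (1 + t\<^sup>2) powr (- (N / 4))"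
      using c t1 by (simp add: K_def powr_mult)
    finally have "norm (g t) \<le> K * (1 + t\<^sup>2) powr (- (N / 4))"
      using g[of t] by linarith
    moreover have "\<bar>t\<bar> ^ k \<le> (1 + t\<^sup>2) powr (k / 2)"
    proof -
      have "\<bar>t\<bar> \<le> sqrt (1 + t\<^sup>2)" by (rule real_le_rsqrt) simp
      then have "\<bar>t\<bar> ^ k \<le> sqrt (1 + t\<^sup>2) ^ k" by (rule power_mono) simp
      also have "\<dots> = (1 + t\<^sup>2) powr (k / 2)"
      proof -
        have "0 < (1 + t\<^sup>2) powr (1/2)" unfolding powr_gt_zero using t1 by linarith
        from powr_realpow[OF this, of k] show ?thesis using t1 by (simp add: powr_half_sqrt[symmetric] powr_powr)
      qed
      finally show ?thesis .
    qed
    ultimately have "norm (t ^ k *\<^sub>R g t) \<le> (1 + t\<^sup>2) powr (k / 2) * (K * (1 + t\<^sup>2) powr (- (N / 4)))"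
      by (auto simp: power_abs intro!: mult_mono)
    also have "\<dots> = K * (1 + t\<^sup>2) powr (k / 2 - N / 4)"
    proof -
      have "(1 + t\<^sup>2) powr (k / 2 - N / 4) = (1 + t\<^sup>2) powr (k / 2) * (1 + t\<^sup>2) powr (- (N / 4))"
        by (simp flip: powr_add)
      then show ?thesis by simp
    qed
    also have "\<dots> \<le> K * (1 + t\<^sup>2) powr (-1)"
      using k t1 by (intro mult_left_mono powr_mono) (auto simp: K_def)
    also have "\<dots> = K * inverse (1 + t\<^sup>2)"
      using t1 by (simp add: powr_minus)
    finally show ?thesis .
  qed
  have int: "integrable lborel (\<lambda>t::real. inverse (1 + t\<^sup>2))"
    using integrable_inverse_1_plus_square by (simp add: set_integrable_def)
  have pi: "(LINT t|lborel. inverse (1 + t\<^sup>2)) = pi"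
    using LBINT_inverse_1_plus_square by (simp add: interval_lebesgue_integral_def set_lebesgue_integral_def)
  show I: "integrable lborel (\<lambda>t. t ^ k *\<^sub>R g t)"
  proof (rule Bochner_Integration.integrable_bound[OF integrable_mult_right[OF int, of K]])
    show "AE t in lborel. norm (t ^ k *\<^sub>R g t) \<le> norm (K * inverse (1 + t\<^sup>2))"
      using bound by (intro AE_I2) (auto intro: order_trans[OF _ abs_ge_self])
  qed measurable
  have "(LINT t|lborel. norm (t ^ k *\<^sub>R g t)) \<le> (LINT t|lborel. K * inverse (1 + t\<^sup>2))"
    by (intro integral_mono integrable_norm I integrable_mult_right int bound)
  then show "(LINT t|lborel. norm (t ^ k *\<^sub>R g t)) \<le> min 1 (4 * l\<^sup>2) powr (- (N / 4)) * pi"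
    by (simp add: pi K_def c_def)
qed

text \<open>The factor \<open>pi\<close> of the moment bound is left out because it cancels against
  the \<open>2 * pi\<close> of Fourier inversion. Each of the two densities then contributes half of
  this constant to the difference.\<close>

definition decay_constant :: "nat \<Rightarrow> real \<Rightarrow> real" where
  "decay_constant N l = min 1 (4 * l\<^sup>2) powr (- (N / 4))"

lemma abs_fourier_inverse_le_decay:
  assumes [measurable]: "g \<in> borel_measurable borel"
    and "\<And>t. norm (g t) \<le> ((1 + 4 * l\<^sup>2 * t\<^sup>2) powr (-1/4)) ^ N"
    and "l \<noteq> 0" "2 * k + 4 \<le> N"
  shows "\<bar>fourier_inverse g k x\<bar> \<le> decay_constant N l / 2"
proof -
  have "\<bar>fourier_inverse g k x\<bar> \<le> (LINT t|lborel. norm (t ^ k *\<^sub>R g t)) / (2 * pi)"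
    by (intro abs_fourier_inverse_le moment_decay(1)[where N=N and l=l] assms)
  also have "\<dots> \<le> decay_constant N l * pi / (2 * pi)"
    unfolding decay_constant_def by (intro divide_right_mono moment_decay(2) assms) auto
  finally show ?thesis by simp
qed

text \<open>From \<open>1 + x <= exp x\<close> at \<open>x = 4 * l^2 * t^2\<close>, raised to the
  power -1/4, and then to the power \<open>N\<close>. The hypothesis is what the variance
  \<open>v\<close>, twice the sum of the squared eigenvalues, satisfies when \<open>N\<close> of
  them have modulus at least \<open>|l|\<close>.\<close>

lemma exp_le_quadratic_decay:
  fixes l t v :: real
  assumes "2 * N * l\<^sup>2 \<le> v"
  shows "exp (- (v * t\<^sup>2) / 2) \<le> ((1 + 4 * l\<^sup>2 * t\<^sup>2) powr (-1/4)) ^ N"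
proof -
  have "exp (- (l\<^sup>2 * t\<^sup>2)) = exp (4 * l\<^sup>2 * t\<^sup>2) powr (-1/4)"
    by (simp add: powr_def)
  also have "\<dots> \<le> (1 + 4 * l\<^sup>2 * t\<^sup>2) powr (-1/4)"
    by (intro powr_mono2') (auto intro: add_pos_nonneg)
  finally have "exp (- (l\<^sup>2 * t\<^sup>2)) ^ N \<le> ((1 + 4 * l\<^sup>2 * t\<^sup>2) powr (-1/4)) ^ N"
    by (rule power_mono) simp
  moreover have "exp (- (v * t\<^sup>2) / 2) \<le> exp (real N * (- (l\<^sup>2 * t\<^sup>2)))"
    using mult_right_mono[OF assms, of "t\<^sup>2"] by simp
  ultimately show ?thesis unfolding exp_of_nat_mult by linarith
qed

text \<open>Among the indices \<open>i < N\<close> the eigenvalue of least modulus is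
  \<open>lam (N - 1)\<close>, and the negative exponent reverses the order.\<close>

lemma prod_decay_le:
  assumes dec: "\<And>i. \<bar>lam (Suc i)\<bar> \<le> \<bar>lam i :: real\<bar>"
  shows "(\<Prod>i<N. (1 + 4 * (lam i)\<^sup>2 * t\<^sup>2) powr (-1/4)) \<le> ((1 + 4 * (lam (N - 1))\<^sup>2 * t\<^sup>2) powr (-1/4)) ^ N"
proof -
  have "(1 + 4 * (lam i)\<^sup>2 * t\<^sup>2) powr (-1/4) \<le> (1 + 4 * (lam (N - 1))\<^sup>2 * t\<^sup>2) powr (-1/4)" if "i < N" for i
  proof (rule powr_mono2')
    have "\<bar>lam (N - 1)\<bar> \<le> \<bar>lam i\<bar>"
      using lift_Suc_antimono_le[of "\<lambda>i. \<bar>lam i\<bar>" i "N - 1"] dec that by simp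
    then show "1 + 4 * (lam (N - 1))\<^sup>2 * t\<^sup>2 \<le> 1 + 4 * (lam i)\<^sup>2 * t\<^sup>2"
      by (intro add_left_mono mult_right_mono) (auto simp: abs_le_square_iff)
  qed (auto intro: add_pos_nonneg)
  then have "(\<Prod>i<N. (1 + 4 * (lam i)\<^sup>2 * t\<^sup>2) powr (-1/4)) \<le> (\<Prod>i<N. (1 + 4 * (lam (N - 1))\<^sup>2 * t\<^sup>2) powr (-1/4))"
    by (intro prod_mono) auto
  then show ?thesis by simp
qed

section \<open>Gaussian quadratic forms\<close>

text \<open>
  Writing \<open>y = z + w\<close> in the double integral for the squared modulus turns the phase \<open>y\<^sup>2 - z\<^sup>2\<close>
  into \<open>w\<^sup>2 + 2 z w\<close>, which is linear in \<open>z\<close>, so both integrations are Gaussian.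
\<close>

lemma norm_char_std_normal_square:
  "norm (CLINT y|std_normal_distribution. iexp (s * y\<^sup>2)) = (1 + 4 * s\<^sup>2) powr (-1/4)"
proof -
  let ?n = std_normal_density
  define \<Phi> where "\<Phi> = (CLINT y|lborel. ?n y *\<^sub>R iexp (s * y\<^sup>2))"
  define H where "H = (\<lambda>z w. (?n z * ?n (z + w)) *\<^sub>R iexp (s * (w\<^sup>2 + 2 * z * w)))"
  have Hm [measurable]: "case_prod H \<in> borel_measurable (lborel \<Otimes>\<^sub>M lborel)"
    unfolding H_def std_normal_density_def by measurable
  have shift: "integrable lborel (\<lambda>w. ?n (z + w))" "(LINT w|lborel. ?n (z + w)) = 1" for z
    using lborel_integrable_real_affine[of ?n 1 z] lborel_integral_real_affine[of 1 ?n z]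
    by auto
  \<comment> \<open>The phase has modulus 1, so Fubini rests on the product of the two densities,
    whose inner integral over \<open>w\<close> is \<open>?n z\<close>.\<close>
  have int: "integrable (lborel \<Otimes>\<^sub>M lborel) (case_prod H)"
  proof (rule lborel_pair.Fubini_integrable)
    show "integrable lborel (\<lambda>z. LINT w|lborel. norm (case_prod H (z, w)))"
      by (simp add: H_def abs_mult shift)
    show "AE z in lborel. integrable lborel (\<lambda>w. case_prod H (z, w))"
    proof (rule AE_I2)
      fix z
      show "integrable lborel (\<lambda>w. case_prod H (z, w))"
        by (rule Bochner_Integration.integrable_bound[OF integrable_mult_right[OF shift(1), of "?n z" z]])
           (auto simp: H_def abs_mult)
    qed
  qed (rule Hm)
  have "\<Phi> * cnj \<Phi> = (CLINT z|lborel. \<Phi> * (?n z *\<^sub>R iexp (- (s * z\<^sup>2))))"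
  proof -
    have "cnj \<Phi> = (CLINT z|lborel. cnj (?n z *\<^sub>R iexp (s * z\<^sup>2)))"
      unfolding \<Phi>_def by (rule Bochner_Integration.integral_cnj[symmetric])
    also have "\<dots> = (CLINT z|lborel. ?n z *\<^sub>R iexp (- (s * z\<^sup>2)))"
      by (intro Bochner_Integration.integral_cong) (auto simp: exp_cnj)
    finally show ?thesis by (simp only: integral_mult_right_zero)
  qed
  also have "\<dots> = (CLINT z|lborel. CLINT w|lborel. H z w)"
  proof (intro Bochner_Integration.integral_cong refl)
    fix z
    have "\<Phi> = (CLINT w|lborel. ?n (z + w) *\<^sub>R iexp (s * (z + w)\<^sup>2))"
      unfolding \<Phi>_def by (subst lborel_integral_real_affine[where c=1 and t=z]) auto
    then have "\<Phi> * (?n z *\<^sub>R iexp (- (s * z\<^sup>2))) =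
        (CLINT w|lborel. (?n (z + w) *\<^sub>R iexp (s * (z + w)\<^sup>2)) * (?n z *\<^sub>R iexp (- (s * z\<^sup>2))))"
      by (simp only: integral_mult_left_zero)
    also have "\<dots> = (CLINT w|lborel. H z w)"
    proof (intro Bochner_Integration.integral_cong refl)
      fix w
      have "iexp (s * (w\<^sup>2 + 2 * z * w)) = iexp (s * (z + w)\<^sup>2) * iexp (- (s * z\<^sup>2))"
        unfolding exp_add[symmetric] by (simp add: power2_eq_square algebra_simps)
      then show "(?n (z + w) *\<^sub>R iexp (s * (z + w)\<^sup>2)) * (?n z *\<^sub>R iexp (- (s * z\<^sup>2))) = H z w"
        unfolding H_def by (simp only: scaleR_conv_of_real of_real_mult mult_ac)
    qed
    finally show "\<Phi> * (?n z *\<^sub>R iexp (- (s * z\<^sup>2))) = (CLINT w|lborel. H z w)" .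
  qed
  also have "\<dots> = (CLINT w|lborel. CLINT z|lborel. H z w)"
    by (rule lborel_pair.Fubini_integral[OF int, symmetric])
  \<comment> \<open>What remains after the integration in \<open>z\<close> is a multiple of the
    centered normal density of variance \<open>2 / (1 + 4 * s^2)\<close>. Its total mass 1 leaves
    the multiple, which is the squared modulus.\<close>
  also have "\<dots> = (CLINT w|lborel. complex_of_real (1 / sqrt (1 + 4 * s\<^sup>2) * normal_density 0 (sqrt (2 / (1 + 4 * s\<^sup>2))) w))"
  proof (intro Bochner_Integration.integral_cong refl)
    fix w
    define c where "c = exp (- w\<^sup>2 / 4) / sqrt (2 * pi)"
    \<comment> \<open>Completing the square, \<open>z^2 + (z+w)^2 = 2 * (z + w/2)^2 + w^2/2\<close>;
      the substitution \<open>z = -w/2 + u / sqrt 2\<close> therefore makes the Gaussian weight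
      standard in \<open>u\<close> and leaves \<open>c\<close>.\<close>
    have "(CLINT z|lborel. H z w) = (1 / sqrt 2) *\<^sub>R (CLINT u|lborel. H (- w / 2 + (1 / sqrt 2) * u) w)"
      by (subst lborel_integral_real_affine[where c="1 / sqrt 2" and t="- w / 2"]) auto
    also have "(CLINT u|lborel. H (- w / 2 + (1 / sqrt 2) * u) w) =
        (CLINT u|lborel. c *\<^sub>R (?n u *\<^sub>R iexp ((sqrt 2 * s * w) * u)))"
    proof (intro Bochner_Integration.integral_cong refl)
      fix u
      let ?z = "- w / 2 + (1 / sqrt 2) * u"
      have sq: "(u / sqrt 2)\<^sup>2 = u\<^sup>2 / 2" by (simp add: power_divide)
      have "?z\<^sup>2 + (?z + w)\<^sup>2 = 2 * (u / sqrt 2)\<^sup>2 + w\<^sup>2 / 2"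
        by (simp add: power2_eq_square field_simps)
      then have e: "- ?z\<^sup>2 / 2 + - (?z + w)\<^sup>2 / 2 = - u\<^sup>2 / 2 + - w\<^sup>2 / 4"
        unfolding sq by simp
      have "exp (- ?z\<^sup>2 / 2) * exp (- (?z + w)\<^sup>2 / 2) = exp (- u\<^sup>2 / 2) * exp (- w\<^sup>2 / 4)"
        unfolding exp_add[symmetric] e ..
      then have 1: "?n ?z * ?n (?z + w) = c * ?n u"
        unfolding std_normal_density_def c_def by (simp add: field_simps)
      have "w\<^sup>2 + 2 * ?z * w = sqrt 2 * w * u"
        by (simp add: power2_eq_square field_simps)
      then have 2: "s * (w\<^sup>2 + 2 * ?z * w) = (sqrt 2 * s * w) * u"
        by simp
      show "H ?z w = c *\<^sub>R (?n u *\<^sub>R iexp ((sqrt 2 * s * w) * u))"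
        unfolding H_def 1 2 by simp
    qed
    also have "\<dots> = c *\<^sub>R complex_of_real (exp (- ((sqrt 2 * s * w)\<^sup>2) / 2))"
      unfolding integral_scaleR_right std_normal_char_lborel ..
    also have "(1 / sqrt 2) *\<^sub>R \<dots> = complex_of_real ((1 / sqrt 2) * c * exp (- ((sqrt 2 * s * w)\<^sup>2) / 2))"
      by (simp add: scaleR_conv_of_real)
    also have "(1 / sqrt 2) * c * exp (- ((sqrt 2 * s * w)\<^sup>2) / 2) =
        1 / sqrt (1 + 4 * s\<^sup>2) * normal_density 0 (sqrt (2 / (1 + 4 * s\<^sup>2))) w"
    proof -
      have pos: "1 + 4 * s\<^sup>2 > 0" by (simp add: add_pos_nonneg)
      have e: "exp (- w\<^sup>2 / 4) * exp (- ((sqrt 2 * s * w)\<^sup>2) / 2) = exp (- (w - 0)\<^sup>2 / (2 * (sqrt (2 / (1 + 4 * s\<^sup>2)))\<^sup>2))"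
        unfolding exp_add[symmetric] using pos by (simp add: power_mult_distrib field_simps)
      have r: "sqrt (2 * pi * (sqrt (2 / (1 + 4 * s\<^sup>2)))\<^sup>2) = sqrt 2 * sqrt (2 * pi) / sqrt (1 + 4 * s\<^sup>2)"
        using pos by (simp add: real_sqrt_mult real_sqrt_divide)
      show ?thesis
        unfolding normal_density_def r e[symmetric] c_def using pos by (simp add: field_simps)
    qed
    finally show "(CLINT z|lborel. H z w) =
      complex_of_real (1 / sqrt (1 + 4 * s\<^sup>2) * normal_density 0 (sqrt (2 / (1 + 4 * s\<^sup>2))) w)" .
  qed
  also have "\<dots> = complex_of_real (1 / sqrt (1 + 4 * s\<^sup>2))"
  proof -
    have "0 < sqrt (2 / (1 + 4 * s\<^sup>2))" by (simp add: add_pos_nonneg)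
    then show ?thesis
      unfolding integral_complex_of_real by (simp add: integral_normal_density)
  qed
  finally have "complex_of_real ((norm \<Phi>)\<^sup>2) = complex_of_real (1 / sqrt (1 + 4 * s\<^sup>2))"
    by (simp only: complex_norm_square)
  then have "(norm \<Phi>)\<^sup>2 = 1 / sqrt (1 + 4 * s\<^sup>2)"
    by (simp only: of_real_eq_iff)
  also have "\<dots> = ((1 + 4 * s\<^sup>2) powr (-1/4))\<^sup>2"
    by (simp add: powr_half_sqrt[symmetric] powr_minus_divide[symmetric] power2_eq_square flip: powr_add)
  finally have "norm \<Phi> = (1 + 4 * s\<^sup>2) powr (-1/4)"
    by (rule power2_eq_imp_eq) auto
  then show ?thesis by (simp add: \<Phi>_def std_normal_integral_lborel)
qed

section \<open>Mean-square estimates and convergence of characteristic functions\<close>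

lemma integral_Cauchy_Schwarz:
  fixes f g :: "'a \<Rightarrow> real"
  assumes [measurable]: "f \<in> borel_measurable M" "g \<in> borel_measurable M"
    and f2: "integrable M (\<lambda>x. (f x)\<^sup>2)" and g2: "integrable M (\<lambda>x. (g x)\<^sup>2)"
  shows "integrable M (\<lambda>x. f x * g x)"
    and "(\<integral>x. f x * g x \<partial>M)\<^sup>2 \<le> (\<integral>x. (f x)\<^sup>2 \<partial>M) * (\<integral>x. (g x)\<^sup>2 \<partial>M)"
proof -
  show fg: "integrable M (\<lambda>x. f x * g x)"
  proof (rule Bochner_Integration.integrable_bound[OF Bochner_Integration.integrable_add[OF f2 g2]])
    have "\<bar>a * b\<bar> \<le> a\<^sup>2 + b\<^sup>2" for a b :: real
    proof -
      have "2 * \<bar>a\<bar> * \<bar>b\<bar> \<le> a\<^sup>2 + b\<^sup>2" using sum_squares_bound[of "\<bar>a\<bar>" "\<bar>b\<bar>"] by simp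
      moreover have "0 \<le> \<bar>a\<bar> * \<bar>b\<bar>" by simp
      ultimately show ?thesis unfolding abs_mult by linarith
    qed
    then show "AE x in M. norm (f x * g x) \<le> norm ((f x)\<^sup>2 + (g x)\<^sup>2)" by simp
  qed simp
  define A where "A = (\<integral>x. (f x)\<^sup>2 \<partial>M)"
  define B where "B = (\<integral>x. (g x)\<^sup>2 \<partial>M)"
  define C where "C = (\<integral>x. f x * g x \<partial>M)"
  have "A \<ge> 0" by (simp add: A_def)
  show "(\<integral>x. f x * g x \<partial>M)\<^sup>2 \<le> (\<integral>x. (f x)\<^sup>2 \<partial>M) * (\<integral>x. (g x)\<^sup>2 \<partial>M)"
  proof (cases "A = 0")
    case True
    then have "AE x in M. (f x)\<^sup>2 = 0"
      unfolding A_def using integral_nonneg_eq_0_iff_AE[OF f2] by simp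
    then have "(\<integral>x. f x * g x \<partial>M) = 0"
      by (intro integral_eq_zero_AE) (auto elim: eventually_mono)
    then show ?thesis by simp
  next
    case False
    \<comment> \<open>The function \<open>A * g - C * f\<close> is \<open>A\<close> times the
      component of \<open>g\<close> orthogonal to \<open>f\<close>.\<close>
    have "0 \<le> (\<integral>x. (A * g x - C * f x)\<^sup>2 \<partial>M)" by simp
    also have "\<dots> = (\<integral>x. A\<^sup>2 * (g x)\<^sup>2 - 2 * A * C * (f x * g x) + C\<^sup>2 * (f x)\<^sup>2 \<partial>M)"
      by (intro Bochner_Integration.integral_cong) (auto simp: power2_eq_square algebra_simps)
    also have "\<dots> = A\<^sup>2 * B - 2 * A * C * C + C\<^sup>2 * A"
      using f2 g2 fg by (simp add: A_def B_def C_def)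
    also have "\<dots> = A * (A * B - C\<^sup>2)" by (simp add: power2_eq_square algebra_simps)
    finally have "0 \<le> A * B - C\<^sup>2" using False \<open>A \<ge> 0\<close> by (simp add: zero_le_mult_iff)
    then show ?thesis by (simp add: A_def B_def C_def)
  qed
qed

lemma integrable_if_square_integrable:
  fixes f :: "'a \<Rightarrow> real"
  assumes "finite_measure M" "f \<in> borel_measurable M" "integrable M (\<lambda>x. (f x)\<^sup>2)"
  shows "integrable M f"
proof -
  interpret finite_measure M by fact
  show ?thesis using integral_Cauchy_Schwarz(1)[of f M "\<lambda>_. 1"] assms by simp
qed

lemma (in prob_space) expectation_abs_le_L2:
  fixes f :: "'a \<Rightarrow> real"
  assumes [measurable]: "f \<in> borel_measurable M" and "integrable M (\<lambda>x. (f x)\<^sup>2)"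
  shows "expectation (\<lambda>x. \<bar>f x\<bar>) \<le> sqrt (expectation (\<lambda>x. (f x)\<^sup>2))"
proof (rule real_le_rsqrt)
  show "(expectation (\<lambda>x. \<bar>f x\<bar>))\<^sup>2 \<le> expectation (\<lambda>x. (f x)\<^sup>2)"
    using integral_Cauchy_Schwarz(2)[of "\<lambda>x. \<bar>f x\<bar>" M "\<lambda>_. 1"] assms(2) by (simp add: prob_space)
qed

lemma L2_tendsto_imp_L1_tendsto:
  fixes S :: "nat \<Rightarrow> 'a \<Rightarrow> real"
  assumes "prob_space M"
    and [measurable]: "\<And>n. S n \<in> borel_measurable M" "F \<in> borel_measurable M"
    and int: "\<And>n. integrable M (\<lambda>x. (F x - S n x)\<^sup>2)"
    and lim: "(\<lambda>n. \<integral>x. (F x - S n x)\<^sup>2 \<partial>M) \<longlonglongrightarrow> 0"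
  shows "(\<lambda>n. \<integral>x. \<bar>F x - S n x\<bar> \<partial>M) \<longlonglongrightarrow> 0"
proof -
  interpret prob_space M by fact
  have "(\<lambda>n. sqrt (\<integral>x. (F x - S n x)\<^sup>2 \<partial>M)) \<longlonglongrightarrow> 0"
    using tendsto_real_sqrt[OF lim] by simp
  from tendsto_sandwich[OF always_eventually always_eventually tendsto_const this]
  show ?thesis by (simp add: expectation_abs_le_L2 int)
qed

text \<open>The map \<open>x\<close> to \<open>exp (itx)\<close> has Lipschitz constant
  \<open>|t|\<close>, so the distance in mean controls the characteristic functions
  pointwise.\<close>

lemma (in prob_space) char_tendsto_if_L1_tendsto:
  fixes S :: "nat \<Rightarrow> 'a \<Rightarrow> real"
  assumes [measurable]: "\<And>n. S n \<in> borel_measurable M" "F \<in> borel_measurable M"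
    and int: "\<And>n. integrable M (\<lambda>x. F x - S n x)"
    and lim: "(\<lambda>n. \<integral>x. \<bar>F x - S n x\<bar> \<partial>M) \<longlonglongrightarrow> 0"
  shows "(\<lambda>n. char (distr M borel (S n)) t) \<longlonglongrightarrow> char (distr M borel F) t"
proof -
  have ie: "integrable M (\<lambda>x. iexp (t * G x))" if "G \<in> borel_measurable M" for G
    using that by (intro integrable_const_bound[of _ 1]) auto
  have "norm (char (distr M borel (S n)) t - char (distr M borel F) t) \<le>
      (\<integral>x. \<bar>F x - S n x\<bar> \<partial>M) * \<bar>t\<bar>" for n
  proof -
    have "norm (char (distr M borel (S n)) t - char (distr M borel F) t) =
        norm (CLINT x|M. iexp (t * S n x) - iexp (t * F x))"
      using ie[of "S n"] ie[of F] by (simp add: char_def integral_distr)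
    also have "\<dots> \<le> (\<integral>x. norm (iexp (t * S n x) - iexp (t * F x)) \<partial>M)"
      by (rule integral_norm_bound)
    also have "\<dots> \<le> (\<integral>x. \<bar>F x - S n x\<bar> * \<bar>t\<bar> \<partial>M)"
    proof (rule integral_mono)
      fix x
      have "iexp (t * S n x) - iexp (t * F x) = iexp (t * F x) * (iexp (t * (S n x - F x)) - 1)"
        by (simp add: algebra_simps flip: exp_add)
      then have "norm (iexp (t * S n x) - iexp (t * F x)) = norm (iexp (t * (S n x - F x)) - 1)"
        by (simp add: norm_mult)
      also have "\<dots> \<le> \<bar>t * (S n x - F x)\<bar>" by (rule iexp_diff_bound)
      finally show "norm (iexp (t * S n x) - iexp (t * F x)) \<le> \<bar>F x - S n x\<bar> * \<bar>t\<bar>"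
        by (simp add: abs_mult abs_minus_commute mult.commute)
    qed (use int ie[of "S n"] ie[of F] in auto)
    finally show ?thesis by simp
  qed
  then have "(\<lambda>n. char (distr M borel (S n)) t - char (distr M borel F) t) \<longlonglongrightarrow> 0"
    by (intro Lim_null_comparison[OF always_eventually tendsto_mult_left_zero[OF lim]]) auto
  then show ?thesis by (rule LIM_zero_cancel)
qed

text \<open>The even moments 1, 3, 15, 105 give \<open>3 - 2 + 1 = 2\<close> and
  \<open>105 - 60 + 18 - 4 + 1 = 60\<close>. The fourth cumulant of one term is thus
  \<open>(60 - 3 * 2^2) * c^4 = 48 * c^4\<close>.\<close>

lemma std_normal_distribution_moments:
  shows "integrable std_normal_distribution (\<lambda>x. (c * (x\<^sup>2 - 1)) ^ p)"
    and "(\<integral>x. c * (x\<^sup>2 - 1) \<partial>std_normal_distribution) = 0"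
    and "(\<integral>x. (c * (x\<^sup>2 - 1))\<^sup>2 \<partial>std_normal_distribution) = 2 * c\<^sup>2"
    and "(\<integral>x. (c * (x\<^sup>2 - 1)) ^ 4 \<partial>std_normal_distribution) = 60 * c ^ 4"
proof -
  interpret real_distribution std_normal_distribution by (rule real_dist_normal_dist)
  note [simp] = integrable_std_normal_distribution_moment prob_space[simplified]
  show "integrable std_normal_distribution (\<lambda>x. (c * (x\<^sup>2 - 1)) ^ p)"
  proof -
    have "(c * (x\<^sup>2 - 1)) ^ p = (\<Sum>k\<le>p. (c ^ p * of_nat (p choose k) * (-1) ^ (p - k)) * (x\<^sup>2) ^ k)" for x
      unfolding power_mult_distrib diff_conv_add_uminus binomial_ring sum_distrib_left
      by (simp add: mult_ac)
    then show ?thesis by (simp flip: power_mult)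
  qed
  have m: "(\<integral>x. x\<^sup>2 \<partial>std_normal_distribution) = 1" "(\<integral>x. x ^ 4 \<partial>std_normal_distribution) = 3"
     "(\<integral>x. x ^ 6 \<partial>std_normal_distribution) = 15" "(\<integral>x. x ^ 8 \<partial>std_normal_distribution) = 105"
    using std_normal_distribution_even_moments(1)[of 1] std_normal_distribution_even_moments(1)[of 2]
      std_normal_distribution_even_moments(1)[of 3] std_normal_distribution_even_moments(1)[of 4]
    by (simp_all add: fact_numeral)
  show "(\<integral>x. c * (x\<^sup>2 - 1) \<partial>std_normal_distribution) = 0"
    by (simp add: m)
  have "(c * (x\<^sup>2 - 1))\<^sup>2 = c\<^sup>2 * (x ^ 4 - 2 * x\<^sup>2 + 1)" for x
    by (simp add: power2_eq_square power4_eq_xxxx algebra_simps)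
  then show "(\<integral>x. (c * (x\<^sup>2 - 1))\<^sup>2 \<partial>std_normal_distribution) = 2 * c\<^sup>2"
    by (simp add: m)
  have "(c * (x\<^sup>2 - 1)) ^ 4 = c ^ 4 * (x ^ 8 - 4 * x ^ 6 + 6 * x ^ 4 - 4 * x\<^sup>2 + 1)" for x
  proof -
    have "(y - 1) ^ 4 = y ^ 4 - 4 * y ^ 3 + 6 * y\<^sup>2 - 4 * y + 1" for y :: real
      by (simp add: eval_nat_numeral algebra_simps)
    from this[of "x\<^sup>2"] show ?thesis by (simp add: power_mult_distrib flip: power_mult)
  qed
  then show "(\<integral>x. (c * (x\<^sup>2 - 1)) ^ 4 \<partial>std_normal_distribution) = 60 * c ^ 4"
    by (simp add: m)
qed

section \<open>Partial sums of the chaos expansion\<close>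

locale gaussian_quadratic_form = prob_space M for M :: "'a measure" +
  fixes Z :: "nat \<Rightarrow> 'a \<Rightarrow> real" and lam :: "nat \<Rightarrow> real"
  assumes indep: "indep_vars (\<lambda>_. borel) Z UNIV"
    and law: "\<And>i. distr M borel (Z i) = std_normal_distribution"
begin

definition Y :: "nat \<Rightarrow> 'a \<Rightarrow> real" where "Y i w = lam i * ((Z i w)\<^sup>2 - 1)"

definition S :: "nat \<Rightarrow> 'a \<Rightarrow> real" where "S n w = (\<Sum>i<n. Y i w)"

lemma Z_measurable [measurable]: "Z i \<in> borel_measurable M"
  using indep by (auto simp: indep_vars_def)

lemma Y_measurable [measurable]: "Y i \<in> borel_measurable M"
  unfolding Y_def by measurable

lemma S_measurable [measurable]: "S i \<in> borel_measurable M"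
  unfolding S_def by measurable

lemma indep_Y: "indep_vars (\<lambda>_. borel) Y UNIV"
proof -
  have "indep_vars (\<lambda>_. borel) (\<lambda>i. (\<lambda>z. lam i * (z\<^sup>2 - 1)) \<circ> Z i) UNIV"
    by (rule indep_vars_compose[OF indep]) measurable
  moreover have "(\<lambda>i. (\<lambda>z. lam i * (z\<^sup>2 - 1)) \<circ> Z i) = Y"
    by (simp add: Y_def fun_eq_iff)
  ultimately show ?thesis by simp
qed

lemma indep_Y_S: "n \<le> k \<Longrightarrow> indep_var borel (Y k) borel (S n)"
  using indep_vars_sum[of "{..<n}" k Y] indep_vars_subset[OF indep_Y, of "insert k {..<n}"]
  by (simp add: S_def[abs_def])

lemma Y_moments:
  shows "integrable M (\<lambda>w. Y i w ^ p)"
    and "expectation (Y i) = 0"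
    and "expectation (\<lambda>w. (Y i w)\<^sup>2) = 2 * (lam i)\<^sup>2"
    and "expectation (\<lambda>w. Y i w ^ 4) = 60 * lam i ^ 4"
proof -
  note m = std_normal_distribution_moments[of "lam i", folded law[of i]]
  show "integrable M (\<lambda>w. Y i w ^ p)"
    using m(1)[of p] by (simp add: Y_def integrable_distr_eq)
  show "expectation (Y i) = 0" "expectation (\<lambda>w. (Y i w)\<^sup>2) = 2 * (lam i)\<^sup>2"
    "expectation (\<lambda>w. Y i w ^ 4) = 60 * lam i ^ 4"
    using m(2-) by (simp_all add: Y_def[abs_def] integral_distr)
qed

text \<open>Induction through the binomial theorem: every mixed term is a product of powers of the
  independent variables \<open>Y n\<close> and \<open>S n\<close>. All exponents are treated at once
  because the expansion involves the lower powers of \<open>S n\<close>.\<close>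

lemma S_powers_integrable: "integrable M (\<lambda>w. S n w ^ p)"
  and Y_S_integrable: "n \<le> k \<Longrightarrow> integrable M (\<lambda>w. Y k w ^ a * S n w ^ b)"
proof -
  have ind: "indep_var borel (\<lambda>w. Y k w ^ a) borel (\<lambda>w. S n w ^ b)" if "n \<le> k" for n k a b
    using indep_var_compose[OF indep_Y_S[OF that], of "\<lambda>x. x ^ a" borel "\<lambda>x. x ^ b" borel]
    by (simp add: comp_def)
  show S: "integrable M (\<lambda>w. S n w ^ p)" for n p
  proof (induction n arbitrary: p)
    case 0
    then show ?case by (simp add: S_def)
  next
    case (Suc n)
    have "S (Suc n) w ^ p = (\<Sum>j\<le>p. of_nat (p choose j) * (Y n w ^ j * S n w ^ (p - j)))" for w
      unfolding binomial_ring[symmetric] mult.assoc[symmetric] by (simp add: S_def add.commute)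
    moreover have "integrable M (\<lambda>w. Y n w ^ j * S n w ^ (p - j))" for j
      by (intro indep_var_integrable ind Y_moments Suc) auto
    ultimately show ?case by simp
  qed
  show "n \<le> k \<Longrightarrow> integrable M (\<lambda>w. Y k w ^ a * S n w ^ b)"
    by (intro indep_var_integrable ind Y_moments S)
qed

lemma expectation_Y_S:
  assumes "n \<le> k"
  shows "expectation (\<lambda>w. Y k w ^ a * S n w ^ b) = expectation (\<lambda>w. Y k w ^ a) * expectation (\<lambda>w. S n w ^ b)"
proof (rule indep_var_lebesgue_integral)
  show "indep_var borel (\<lambda>w. Y k w ^ a) borel (\<lambda>w. S n w ^ b)"
    using indep_var_compose[OF indep_Y_S[OF assms], of "\<lambda>x. x ^ a" borel "\<lambda>x. x ^ b" borel]
    by (simp add: comp_def)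
qed (simp_all add: Y_moments S_powers_integrable)

lemma expectation_S: "expectation (S n) = 0"
  using Y_moments(1)[of _ 1] by (simp add: S_def[abs_def] Y_moments)

lemma expectation_S_square: "expectation (\<lambda>w. (S n w)\<^sup>2) = 2 * (\<Sum>i<n. (lam i)\<^sup>2)"
proof (induction n)
  case (Suc n)
  have "(S (Suc n) w)\<^sup>2 = (S n w)\<^sup>2 + (2 * (Y n w ^ 1 * S n w ^ 1) + (Y n w)\<^sup>2)" for w
    by (simp add: S_def power2_eq_square algebra_simps)
  then have "expectation (\<lambda>w. (S (Suc n) w)\<^sup>2) =
      expectation (\<lambda>w. (S n w)\<^sup>2) + (2 * expectation (\<lambda>w. Y n w ^ 1 * S n w ^ 1) + expectation (\<lambda>w. (Y n w)\<^sup>2))"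
    using Y_S_integrable[of n n 1 1] by (simp add: S_powers_integrable Y_moments)
  then show ?case
    unfolding expectation_Y_S[OF order_refl] Suc by (simp add: Y_moments)
qed (simp add: S_def)

text \<open>This is additivity of the fourth cumulant, \<open>12 * (...)^2\<close> being three times
  the squared variance. In the step the odd mixed terms vanish since \<open>Y n\<close> and
  \<open>S n\<close> are centered, and \<open>60 * lam n ^ 4\<close> splits as
  \<open>12 + 48\<close>.\<close>

lemma expectation_S_fourth:
  "expectation (\<lambda>w. S n w ^ 4) = 12 * (\<Sum>i<n. (lam i)\<^sup>2)\<^sup>2 + 48 * (\<Sum>i<n. lam i ^ 4)"
proof (induction n)
  case (Suc n)
  have "S (Suc n) w ^ 4 = S n w ^ 4 + (4 * (Y n w ^ 1 * S n w ^ 3) + (6 * (Y n w ^ 2 * S n w ^ 2) +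
      (4 * (Y n w ^ 3 * S n w ^ 1) + Y n w ^ 4)))" for w
    by (simp add: S_def eval_nat_numeral algebra_simps)
  then have "expectation (\<lambda>w. S (Suc n) w ^ 4) =
      expectation (\<lambda>w. S n w ^ 4) + (4 * expectation (\<lambda>w. Y n w ^ 1 * S n w ^ 3) + (6 * expectation (\<lambda>w. Y n w ^ 2 * S n w ^ 2) +
      (4 * expectation (\<lambda>w. Y n w ^ 3 * S n w ^ 1) + expectation (\<lambda>w. Y n w ^ 4))))"
    using Y_S_integrable[of n n 1 3] Y_S_integrable[of n n 3 1]
    by (simp add: S_powers_integrable Y_S_integrable Y_moments)
  then show ?case
    unfolding expectation_Y_S[OF order_refl] Suc
    by (simp add: Y_moments expectation_S expectation_S_square) (simp add: eval_nat_numeral algebra_simps)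
qed (simp add: S_def)

lemma norm_char_S:
  "norm (char (distr M borel (S n)) t) = (\<Prod>i<n. (1 + 4 * (lam i)\<^sup>2 * t\<^sup>2) powr (-1/4))"
proof -
  have "char (distr M borel (S n)) t = (\<Prod>i<n. char (distr M borel (Y i)) t)"
    using char_distr_sum[OF indep_vars_subset[OF indep_Y subset_UNIV], of "{..<n}" t]
    by (simp add: S_def[abs_def])
  moreover have "norm (char (distr M borel (Y i)) t) = (1 + 4 * (lam i)\<^sup>2 * t\<^sup>2) powr (-1/4)" for i
  proof -
    have "char (distr M borel (Y i)) t = (CLINT w|M. iexp (t * (lam i * ((Z i w)\<^sup>2 - 1))))"
      by (simp add: char_def integral_distr Y_def)
    also have "\<dots> = (CLINT z|distr M borel (Z i). iexp (t * (lam i * (z\<^sup>2 - 1))))"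
      by (subst integral_distr) auto
    \<comment> \<open>The centering by 1 only contributes a phase of modulus 1.\<close>
    also have "\<dots> = (CLINT z|std_normal_distribution. iexp (- (t * lam i)) * iexp (t * lam i * z\<^sup>2))"
      unfolding law by (intro Bochner_Integration.integral_cong) (auto simp: algebra_simps simp flip: exp_add)
    also have "\<dots> = iexp (- (t * lam i)) * (CLINT z|std_normal_distribution. iexp (t * lam i * z\<^sup>2))"
      by (rule integral_mult_right_zero)
    finally have "norm (char (distr M borel (Y i)) t) = norm (CLINT z|std_normal_distribution. iexp (t * lam i * z\<^sup>2))"
      by (simp add: norm_mult)
    then show ?thesis
      unfolding norm_char_std_normal_square by (simp add: power_mult_distrib mult_ac)
  qed
  ultimately show ?thesis by (simp add: prod_norm[symmetric])
qed

text \<open>The increment is a sum of centered \<open>Y j\<close> with \<open>j >= n\<close>, each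
  independent of \<open>S n\<close>. Integrability is carried along because additivity of the
  integral needs it in the induction.\<close>

lemma expectation_S_cube_increment:
  assumes "n \<le> k"
  shows "expectation (\<lambda>w. S n w ^ 3 * (S k w - S n w)) = 0 \<and> integrable M (\<lambda>w. S n w ^ 3 * (S k w - S n w))"
  using assms
proof (induction k rule: dec_induct)
  case (step k)
  have "S n w ^ 3 * (S (Suc k) w - S n w) = S n w ^ 3 * (S k w - S n w) + Y k w ^ 1 * S n w ^ 3" for w
    by (simp add: S_def algebra_simps)
  then show ?case
    using step expectation_Y_S[OF step.hyps(1), of 1 3] Y_S_integrable[OF step.hyps(1), of 1 3]
    by (simp add: Y_moments)
qed simp

end

section \<open>Passage to the mean-square limit\<close>

context gaussian_quadratic_form
begin

context
  fixes F :: "'a \<Rightarrow> real"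
  assumes F [measurable]: "F \<in> borel_measurable M" and F2: "integrable M (\<lambda>w. (F w)\<^sup>2)"
    and lim: "(\<lambda>n. expectation (\<lambda>w. (F w - S n w)\<^sup>2)) \<longlonglongrightarrow> 0"
begin

lemma limit_diff_square_integrable: "integrable M (\<lambda>w. (F w - S n w)\<^sup>2)"
proof -
  have "(F w - S n w)\<^sup>2 = (F w)\<^sup>2 - 2 * (F w * S n w) + (S n w)\<^sup>2" for w
    by (simp add: power2_eq_square algebra_simps)
  moreover have "integrable M (\<lambda>w. F w * S n w)"
    using F2 S_powers_integrable[of n 2] by (intro integral_Cauchy_Schwarz) auto
  ultimately show ?thesis
    using F2 S_powers_integrable[of n 2] by simp
qed

lemma limit_diff_integrable: "integrable M (\<lambda>w. F w - S n w)"
  by (rule integrable_if_square_integrable[OF finite_measure_axioms _ limit_diff_square_integrable]) measurable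

lemma limit_L1: "(\<lambda>n. expectation (\<lambda>w. \<bar>F w - S n w\<bar>)) \<longlonglongrightarrow> 0"
  by (rule L2_tendsto_imp_L1_tendsto[OF prob_space_axioms _ _ limit_diff_square_integrable lim]) measurable

text \<open>Every factor is at most 1, so the partial products decrease and the \<open>n\<close>-th
  one bounds all later characteristic functions, hence their limit.\<close>

lemma norm_char_limit_le:
  "norm (char (distr M borel F) t) \<le> (\<Prod>i<n. (1 + 4 * (lam i)\<^sup>2 * t\<^sup>2) powr (-1/4))"
proof (rule LIMSEQ_le_const2)
  show "(\<lambda>k. norm (char (distr M borel (S k)) t)) \<longlonglongrightarrow> norm (char (distr M borel F) t)"
    by (intro tendsto_norm char_tendsto_if_L1_tendsto limit_diff_integrable limit_L1) measurable
  let ?P = "\<lambda>k. \<Prod>i<k. (1 + 4 * (lam i)\<^sup>2 * t\<^sup>2) powr (-1/4)"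
  have "?P k \<le> ?P n" if "n \<le> k" for k
    using that
  proof (induction k rule: dec_induct)
    case (step k)
    have "(1 + 4 * (lam k)\<^sup>2 * t\<^sup>2) powr (-1/4) \<le> (1 + 4 * (lam k)\<^sup>2 * t\<^sup>2) powr 0"
      by (intro powr_mono) auto
    then have "?P k * (1 + 4 * (lam k)\<^sup>2 * t\<^sup>2) powr (-1/4) \<le> ?P k"
      by (intro mult_right_le_one_le prod_nonneg) (auto split: if_splits)
    with step show ?case by simp
  qed simp
  then show "\<exists>N. \<forall>k\<ge>N. norm (char (distr M borel (S k)) t) \<le> ?P n"
    unfolding norm_char_S by blast
qed

text \<open>Fatou's lemma along an almost everywhere convergent subsequence, with the explicit
  fourth moments of \<open>S n\<close> as uniform bound. Without this the expectation of
  \<open>F ^ 4\<close> could be the default value 0 of a non-integrable function.\<close>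

lemma integrable_limit_fourth:
  assumes A: "\<And>n. (\<Sum>i<n. (lam i)\<^sup>2) \<le> A" and B: "\<And>n. (\<Sum>i<n. lam i ^ 4) \<le> B"
  shows "integrable M (\<lambda>w. F w ^ 4)"
proof -
  obtain r where r: "strict_mono r" and AE: "AE w in M. (\<lambda>n. F w - S (r n) w) \<longlonglongrightarrow> 0"
    using tendsto_L1_AE_subseq[of M "\<lambda>n w. F w - S n w"] limit_diff_integrable limit_L1 by auto
  have "(\<integral>\<^sup>+w. ennreal (F w ^ 4) \<partial>M) = (\<integral>\<^sup>+w. liminf (\<lambda>n. ennreal (S (r n) w ^ 4)) \<partial>M)"
  proof (rule nn_integral_cong_AE)
    show "AE w in M. ennreal (F w ^ 4) = liminf (\<lambda>n. ennreal (S (r n) w ^ 4))"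
      using AE
    proof eventually_elim
      case (elim w)
      have "(\<lambda>n. F w - (F w - S (r n) w)) \<longlonglongrightarrow> F w - 0"
        by (intro tendsto_diff tendsto_const elim)
      then have "(\<lambda>n. ennreal (S (r n) w ^ 4)) \<longlonglongrightarrow> ennreal (F w ^ 4)"
        by (intro tendsto_ennrealI tendsto_power) simp
      then show ?case
        by (rule lim_imp_Liminf[OF sequentially_bot, symmetric])
    qed
  qed
  also have "\<dots> \<le> liminf (\<lambda>n. \<integral>\<^sup>+w. ennreal (S (r n) w ^ 4) \<partial>M)"
    by (rule nn_integral_liminf) measurable
  also have "\<dots> \<le> limsup (\<lambda>n. \<integral>\<^sup>+w. ennreal (S (r n) w ^ 4) \<partial>M)"
    by (rule Liminf_le_Limsup) simp
  also have "\<dots> \<le> ennreal (12 * A\<^sup>2 + 48 * B)"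
  proof (rule Limsup_bounded, rule always_eventually, rule allI)
    fix n
    have "(\<integral>\<^sup>+w. ennreal (S (r n) w ^ 4) \<partial>M) = ennreal (expectation (\<lambda>w. S (r n) w ^ 4))"
      by (rule nn_integral_eq_integral) (auto simp: S_powers_integrable)
    also have "\<dots> \<le> ennreal (12 * A\<^sup>2 + 48 * B)"
      unfolding expectation_S_fourth
      by (intro ennreal_leI add_mono mult_left_mono power_mono A B sum_nonneg) auto
    finally show "(\<integral>\<^sup>+w. ennreal (S (r n) w ^ 4) \<partial>M) \<le> ennreal (12 * A\<^sup>2 + 48 * B)" .
  qed
  finally have "(\<integral>\<^sup>+w. ennreal (F w ^ 4) \<partial>M) < \<infinity>"
    by (rule order.strict_trans1) simp
  then show ?thesis
    by (intro integrableI_nonneg) auto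
qed

text \<open>Replacing \<open>F - S n\<close> by \<open>F - S k\<close> with \<open>k >= n\<close>
  leaves the expectation unchanged, by orthogonality of the increments. Cauchy-Schwarz with the
  sixth moment of \<open>S n\<close> then lets \<open>k\<close> tend to infinity.\<close>

lemma expectation_S_cube_limit:
  shows "integrable M (\<lambda>w. S n w ^ 3 * (F w - S n w))"
    and "expectation (\<lambda>w. S n w ^ 3 * (F w - S n w)) = 0"
proof -
  have int: "integrable M (\<lambda>w. S n w ^ 3 * (F w - S k w))" and
    cs: "(expectation (\<lambda>w. S n w ^ 3 * (F w - S k w)))\<^sup>2 \<le> expectation (\<lambda>w. S n w ^ 6) * expectation (\<lambda>w. (F w - S k w)\<^sup>2)" for k
    using integral_Cauchy_Schwarz[of "\<lambda>w. S n w ^ 3" M "\<lambda>w. F w - S k w"] S_powers_integrable[of n 6]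
      limit_diff_square_integrable[of k] by (simp_all flip: power_mult)
  show "integrable M (\<lambda>w. S n w ^ 3 * (F w - S n w))" by (rule int)
  let ?e = "expectation (\<lambda>w. S n w ^ 3 * (F w - S n w))"
  have "?e = expectation (\<lambda>w. S n w ^ 3 * (F w - S k w))" if "n \<le> k" for k
  proof -
    have "S n w ^ 3 * (F w - S n w) = S n w ^ 3 * (F w - S k w) + S n w ^ 3 * (S k w - S n w)" for w
      by (simp add: algebra_simps)
    then show ?thesis
      using expectation_S_cube_increment[OF that] int[of k] by simp
  qed
  then have "?e\<^sup>2 \<le> expectation (\<lambda>w. S n w ^ 6) * expectation (\<lambda>w. (F w - S k w)\<^sup>2)" if "n \<le> k" for k
    using cs[of k] that by simp
  then have "?e\<^sup>2 \<le> 0"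
    by (intro LIMSEQ_le_const[OF tendsto_mult_right_zero[OF lim]]) blast
  then show "?e = 0" by simp
qed

text \<open>Convexity of \<open>x\<^sup>4\<close> and orthogonality of \<open>S n\<^sup>3\<close> to the remainder avoid any uniform integrability.\<close>

lemma expectation_S_fourth_le:
  assumes "integrable M (\<lambda>w. F w ^ 4)"
  shows "expectation (\<lambda>w. S n w ^ 4) \<le> expectation (\<lambda>w. F w ^ 4)"
proof -
  have tangent: "a ^ 4 + 4 * (a ^ 3 * (b - a)) \<le> b ^ 4" for a b :: real
  proof -
    \<comment> \<open>Tangency gives a double root at \<open>b = a\<close>; the remaining quadratic
      factor is a sum of squares.\<close>
    have "b ^ 4 - (a ^ 4 + 4 * (a ^ 3 * (b - a))) = (b - a)\<^sup>2 * ((b + a)\<^sup>2 + 2 * a\<^sup>2)"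
      by (simp add: eval_nat_numeral algebra_simps)
    also have "\<dots> \<ge> 0" by simp
    finally show ?thesis by simp
  qed
  have "expectation (\<lambda>w. S n w ^ 4) = expectation (\<lambda>w. S n w ^ 4 + 4 * (S n w ^ 3 * (F w - S n w)))"
    using expectation_S_cube_limit[of n] S_powers_integrable[of n 4] by simp
  also have "\<dots> \<le> expectation (\<lambda>w. F w ^ 4)"
    using assms expectation_S_cube_limit[of n] S_powers_integrable[of n 4] by (intro integral_mono tangent) auto
  finally show ?thesis .
qed

end

end

lemma summable_fourth_powers:
  fixes lam :: "nat \<Rightarrow> real"
  assumes "summable (\<lambda>i. (lam i)\<^sup>2)"
  shows "summable (\<lambda>i. lam i ^ 4)"
proof (rule summable_comparison_test'[where N = 0])
  show "summable (\<lambda>i. (\<Sum>j. (lam j)\<^sup>2) * (lam i)\<^sup>2)"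
    using assms by (rule summable_mult)
  fix i
  have "(lam i)\<^sup>2 \<le> (\<Sum>j. (lam j)\<^sup>2)"
    using sum_le_suminf[OF assms, of "{i}"] by simp
  then have "(lam i)\<^sup>2 * (lam i)\<^sup>2 \<le> (\<Sum>j. (lam j)\<^sup>2) * (lam i)\<^sup>2"
    by (intro mult_right_mono) auto
  moreover have "norm (lam i ^ 4) = (lam i)\<^sup>2 * (lam i)\<^sup>2"
    unfolding norm_power power_add[symmetric] by (simp add: power_even_abs)
  ultimately show "norm (lam i ^ 4) \<le> (\<Sum>j. (lam j)\<^sup>2) * (lam i)\<^sup>2" by (rule ord_eq_le_trans[rotated])
qed

context gaussian_quadratic_form
begin

text \<open>Each partial fourth moment is explicit and at most that of \<open>F\<close>, so its
  limit \<open>12 * A^2 + 48 * B\<close> is too. Since \<open>A\<close> is half the second moment of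
  \<open>F\<close>, the first term is three times the squared variance.\<close>

lemma fourth_moment_limit:
  assumes F [measurable]: "F \<in> borel_measurable M" and F2: "integrable M (\<lambda>w. (F w)\<^sup>2)"
    and lim: "(\<lambda>n. expectation (\<lambda>w. (F w - S n w)\<^sup>2)) \<longlonglongrightarrow> 0"
    and sq: "(\<lambda>i. (lam i)\<^sup>2) sums (expectation (\<lambda>w. (F w)\<^sup>2) / 2)"
  shows "48 * (\<Sum>i. lam i ^ 4) \<le> expectation (\<lambda>w. F w ^ 4) - 3 * (expectation (\<lambda>w. (F w)\<^sup>2))\<^sup>2"
proof -
  define A where "A = expectation (\<lambda>w. (F w)\<^sup>2) / 2"
  define B where "B = (\<Sum>i. lam i ^ 4)"
  have sA: "(\<lambda>i. (lam i)\<^sup>2) sums A" using sq by (simp add: A_def)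
  have sB: "(\<lambda>i. lam i ^ 4) sums B"
    unfolding B_def by (intro summable_sums summable_fourth_powers sums_summable[OF sA])
  have "(\<Sum>i<n. (lam i)\<^sup>2) \<le> A" for n
    using sum_le_suminf[OF sums_summable[OF sA], of "{..<n}"] sums_unique[OF sA] by simp
  moreover have "(\<Sum>i<n. lam i ^ 4) \<le> B" for n
    using sum_le_suminf[OF sums_summable[OF sB], of "{..<n}"] sums_unique[OF sB] by simp
  ultimately have F4: "integrable M (\<lambda>w. F w ^ 4)"
    by (rule integrable_limit_fourth[OF F F2 lim])
  have "(\<lambda>n. 12 * (\<Sum>i<n. (lam i)\<^sup>2)\<^sup>2 + 48 * (\<Sum>i<n. lam i ^ 4)) \<longlonglongrightarrow> 12 * A\<^sup>2 + 48 * B"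
    using sA sB unfolding sums_def by (intro tendsto_intros)
  then have "12 * A\<^sup>2 + 48 * B \<le> expectation (\<lambda>w. F w ^ 4)"
    by (rule LIMSEQ_le_const2)
       (use expectation_S_fourth_le[OF F F2 lim F4] expectation_S_fourth in auto)
  moreover have "3 * (expectation (\<lambda>w. (F w)\<^sup>2))\<^sup>2 = 12 * A\<^sup>2"
    by (simp add: A_def power_divide)
  ultimately show ?thesis by (simp add: B_def)
qed

text \<open>The characteristic functions \<open>g\<close> of \<open>F\<close> and \<open>h\<close>
  of the normal law satisfy the same bound with the same \<open>N\<close> and \<open>l\<close>. The
  bound \<open>2 * m + 6 <= N\<close> is \<open>2 * k + 4 <= N\<close> at \<open>k = m + 1\<close>,
  the highest moment that \<open>deriv_fourier_inverse\<close> asks for.\<close>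

lemma smooth_density_limit:
  assumes F [measurable]: "F \<in> borel_measurable M" and F2: "integrable M (\<lambda>w. (F w)\<^sup>2)"
    and lim: "(\<lambda>n. expectation (\<lambda>w. (F w - S n w)\<^sup>2)) \<longlonglongrightarrow> 0"
    and sq: "(\<lambda>i. (lam i)\<^sup>2) sums (expectation (\<lambda>w. (F w)\<^sup>2) / 2)"
    and dec: "\<And>i. \<bar>lam (Suc i)\<bar> \<le> \<bar>lam i\<bar>" and l0: "lam (N - 1) \<noteq> 0" and N: "2 * m + 6 \<le> N"
  obtains fF where "\<And>x. 0 \<le> fF x" "distributed M lborel F (\<lambda>x. ennreal (fF x))" "continuously_differentiable m fF"
    "\<And>k x. k \<le> m \<Longrightarrow> \<bar>(deriv ^^ k) fF x - (deriv ^^ k) (normal_density 0 (sqrt (expectation (\<lambda>w. (F w)\<^sup>2)))) x\<bar>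
       \<le> decay_constant N (lam (N - 1))"
proof -
  define l where "l = lam (N - 1)"
  define v where "v = expectation (\<lambda>w. (F w)\<^sup>2)"
  define g where "g = char (distr M borel F)"
  define h where "h = (\<lambda>t. complex_of_real (exp (- ((sqrt v)\<^sup>2 * t\<^sup>2) / 2)))"
  interpret D: real_distribution "distr M borel F" by (rule real_distribution_distr) simp
  have l: "l \<noteq> 0" using l0 by (simp add: l_def)
  have gm [measurable]: "g \<in> borel_measurable borel" unfolding g_def by measurable
  have hm [measurable]: "h \<in> borel_measurable borel" unfolding h_def by measurable
  have gb: "norm (g t) \<le> ((1 + 4 * l\<^sup>2 * t\<^sup>2) powr (-1/4)) ^ N" for t
    unfolding g_def l_def
    by (rule order_trans[OF norm_char_limit_le[OF F F2 lim, of t N] prod_decay_le[of lam, OF dec]])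
  \<comment> \<open>The first \<open>N\<close> squared eigenvalues already sum to at least
    \<open>N * l^2\<close>, which makes the Gaussian decay fast enough and the variance
    positive.\<close>
  have "real N * l\<^sup>2 \<le> (\<Sum>i<N. (lam i)\<^sup>2)"
  proof -
    have "l\<^sup>2 \<le> (lam i)\<^sup>2" if "i < N" for i
      using lift_Suc_antimono_le[of "\<lambda>i. \<bar>lam i\<bar>" i "N - 1"] dec that by (simp add: l_def abs_le_square_iff)
    then have "(\<Sum>i<N. l\<^sup>2) \<le> (\<Sum>i<N. (lam i)\<^sup>2)" by (intro sum_mono) auto
    then show ?thesis by simp
  qed
  also have "\<dots> \<le> v / 2"
    using sum_le_suminf[OF sums_summable[OF sq], of "{..<N}"] sums_unique[OF sq] by (simp add: v_def)
  finally have v: "2 * real N * l\<^sup>2 \<le> v" by simp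
  have "0 < 2 * real N * l\<^sup>2" using l N by simp
  with v have v0: "0 < v" by linarith
  have hb: "norm (h t) \<le> ((1 + 4 * l\<^sup>2 * t\<^sup>2) powr (-1/4)) ^ N" for t
    unfolding h_def using v0 exp_le_quadratic_decay[OF v, of t] by (simp add: norm_of_real)
  have int: "integrable lborel (\<lambda>t. t ^ k *\<^sub>R g t)" "integrable lborel (\<lambda>t. t ^ k *\<^sub>R h t)" if "k \<le> Suc m" for k
    using that N by (intro moment_decay(1)[OF gm gb l] moment_decay(1)[OF hm hb l]; simp)+
  have int01: "integrable lborel g" "integrable lborel (\<lambda>t. t *\<^sub>R g t)"
    using int(1)[of 0] int(1)[of 1] by simp_all
  have dg: "k \<le> m \<Longrightarrow> (deriv ^^ k) (fourier_inverse g 0) = fourier_inverse g k"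
    "k < m \<Longrightarrow> fourier_inverse g k differentiable at x"
    "k \<le> m \<Longrightarrow> continuous_on UNIV (fourier_inverse g k)" for k x
    by (rule deriv_fourier_inverse[OF gm int(1)]; assumption)+
  have dh: "(deriv ^^ k) (fourier_inverse h 0) = fourier_inverse h k" if "k \<le> m" for k
    by (rule deriv_fourier_inverse(1)[OF hm int(2) that])
  have \<phi>: "normal_density 0 (sqrt v) = fourier_inverse h 0"
    unfolding h_def using v0 by (intro normal_density_eq_fourier_inverse) simp
  show thesis
  proof
    show "0 \<le> fourier_inverse g 0 x" for x
      using distributed_fourier_inverse(1)[OF F] int01 by (simp add: g_def)
    show "distributed M lborel F (\<lambda>x. ennreal (fourier_inverse g 0 x))"
      using distributed_fourier_inverse(2)[OF F] int01 by (simp add: g_def)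
    show "continuously_differentiable m (fourier_inverse g 0)"
      unfolding continuously_differentiable_def using dg by simp
    show "\<bar>(deriv ^^ k) (fourier_inverse g 0) x - (deriv ^^ k) (normal_density 0 (sqrt (expectation (\<lambda>w. (F w)\<^sup>2)))) x\<bar>
        \<le> decay_constant N (lam (N - 1))" if k: "k \<le> m" for k x
    proof -
      have "\<bar>fourier_inverse g k x\<bar> \<le> decay_constant N l / 2"
        using k N by (intro abs_fourier_inverse_le_decay gm gb l) simp
      moreover have "\<bar>fourier_inverse h k x\<bar> \<le> decay_constant N l / 2"
        using k N by (intro abs_fourier_inverse_le_decay hm hb l) simp
      ultimately have "\<bar>fourier_inverse g k x - fourier_inverse h k x\<bar> \<le> decay_constant N l"
        by linarith
      then show ?thesis
        unfolding v_def[symmetric] \<phi> dg(1)[OF k] dh[OF k] l_def .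
    qed
  qed
qed

end

section \<open>Isonormal processes and double stochastic integrals\<close>

text \<open>Expressing the characteristic function through the variance lets one formula cover the
  degenerate case too, where both sides are 1.\<close>

lemma (in prob_space) centered_gaussian_square_and_char:
  assumes "centered_gaussian M Y"
  shows "integrable M (\<lambda>w. (Y w)\<^sup>2)"
    and "(CLINT w|M. iexp (Y w)) = exp (- expectation (\<lambda>w. (Y w)\<^sup>2) / 2)"
proof -
  have [measurable]: "Y \<in> borel_measurable M" using assms by (simp add: centered_gaussian_def)
  have "integrable M (\<lambda>w. (Y w)\<^sup>2) \<and> (CLINT w|M. iexp (Y w)) = exp (- expectation (\<lambda>w. (Y w)\<^sup>2) / 2)"
    using assms unfolding centered_gaussian_def
  proof (elim conjE disjE exE)
    assume 0: "AE w in M. Y w = 0"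
    have "integrable M (\<lambda>w. (Y w)\<^sup>2) = integrable M (\<lambda>w. 0 :: real)"
      by (rule integrable_cong_AE) (use 0 in auto)
    moreover have "expectation (\<lambda>w. (Y w)\<^sup>2) = expectation (\<lambda>w. 0)"
      by (rule integral_cong_AE) (use 0 in auto)
    moreover have "(CLINT w|M. iexp (Y w)) = (CLINT w|M. 1)"
      by (rule integral_cong_AE) (use 0 in auto)
    ultimately show ?thesis by (simp add: prob_space)
  next
    fix \<sigma> :: real
    assume \<sigma>: "\<sigma> > 0" and d: "distributed M lborel Y (normal_density 0 \<sigma>)"
    define Z where "Z = (\<lambda>w. Y w / \<sigma>)"
    have "distributed M lborel Z std_normal_density"
      using d normal_standard_normal_convert[OF \<sigma>, of Y 0] by (simp add: Z_def)
    then have "distr M lborel Z = std_normal_distribution"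
      by (rule distributed_distr_eq_density)
    then have law: "distr M borel Z = std_normal_distribution"
      by (simp cong: distr_cong)
    have [measurable]: "Z \<in> borel_measurable M" by (simp add: Z_def)
    have Y: "Y w = \<sigma> * Z w" for w using \<sigma> by (simp add: Z_def)
    have iZ: "integrable M (\<lambda>w. (Z w)\<^sup>2)"
      using integrable_std_normal_distribution_moment[of 2] by (simp add: law[symmetric] integrable_distr_eq)
    have "expectation (\<lambda>w. (Z w)\<^sup>2) = 1"
      using std_normal_distribution_even_moments(1)[of 1] by (simp add: law[symmetric] integral_distr)
    then have E: "expectation (\<lambda>w. (Y w)\<^sup>2) = \<sigma>\<^sup>2" by (simp add: Y power_mult_distrib)
    have "(CLINT w|M. iexp (Y w)) = char (distr M borel Z) \<sigma>"
      by (simp add: char_def integral_distr Y)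
    then have "(CLINT w|M. iexp (Y w)) = exp (- (\<sigma>\<^sup>2) / 2)"
      by (simp add: law char_std_normal_distribution exp_of_real)
    then show ?thesis using iZ E by (simp add: Y power_mult_distrib)
  qed
  then show "integrable M (\<lambda>w. (Y w)\<^sup>2)"
    and "(CLINT w|M. iexp (Y w)) = exp (- expectation (\<lambda>w. (Y w)\<^sup>2) / 2)" by auto
qed

text \<open>By orthonormality a linear combination with coefficients \<open>c j\<close> has variance
  equal to the sum of the \<open>(c j)^2\<close>, so its characteristic function splits into the
  one-dimensional ones.\<close>

lemma isonormal_process_indep_std_normal:
  fixes e :: "nat \<Rightarrow> 'h::real_inner"
  assumes M: "prob_space M" and X: "isonormal_process M X"
    and e: "\<And>i j. inner (e i) (e j) = (if i = j then 1 else 0)"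
  shows "prob_space.indep_vars M (\<lambda>_. borel) (\<lambda>i. X (e i)) UNIV"
    and "distr M borel (X (e i)) = std_normal_distribution"
proof -
  interpret prob_space M by fact
  have gauss: "finite S \<Longrightarrow> centered_gaussian M (\<lambda>w. \<Sum>h\<in>S. c h * X h w)" for S c
    using X by (simp add: isonormal_process_def)
  have cov: "expectation (\<lambda>w. X h w * X g w) = inner h g" for h g
    using X by (simp add: isonormal_process_def)
  have "centered_gaussian M (X h)" for h
    using gauss[of "{h}" "\<lambda>_. 1"] by simp
  then have Xm [measurable]: "X h \<in> borel_measurable M" and X2: "integrable M (\<lambda>w. (X h w)\<^sup>2)" for h
    by (auto simp: centered_gaussian_def intro: centered_gaussian_square_and_char(1))
  have Xi: "integrable M (\<lambda>w. X h w * X g w)" for h g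
    by (intro integral_Cauchy_Schwarz X2) auto
  have "inj e"
    by (rule injI) (metis e zero_neq_one)
  have char: "(CLINT w|M. iexp (\<Sum>j\<in>J. c j * X (e j) w)) = (\<Prod>j\<in>J. exp (- of_real ((c j)\<^sup>2) / 2))"
    if J: "finite J" for J c
  proof -
    let ?Y = "\<lambda>w. \<Sum>j\<in>J. c j * X (e j) w"
    \<comment> \<open>Gaussian families are indexed by vectors, not by indices; re-indexing the sum
      requires \<open>e\<close> to be injective.\<close>
    have "?Y = (\<lambda>w. \<Sum>h\<in>e ` J. c (inv e h) * X h w)"
      using \<open>inj e\<close> by (auto simp: sum.reindex inj_on_subset)
    then have Y: "centered_gaussian M ?Y"
      using gauss[of "e ` J" "\<lambda>h. c (inv e h)"] J by simp
    have "(?Y w)\<^sup>2 = (\<Sum>i\<in>J. \<Sum>j\<in>J. (c i * c j) * (X (e i) w * X (e j) w))" for w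
      unfolding power2_eq_square sum_product by (simp add: mult_ac)
    then have "expectation (\<lambda>w. (?Y w)\<^sup>2) = (\<Sum>i\<in>J. \<Sum>j\<in>J. (c i * c j) * inner (e i) (e j))"
      using Xi by (simp add: cov)
    also have "\<dots> = (\<Sum>i\<in>J. (c i)\<^sup>2)"
      using J by (simp add: e if_distrib[of "(*) _"] power2_eq_square cong: if_cong)
    finally show ?thesis
      using centered_gaussian_square_and_char(2)[OF Y] J
      by (simp add: exp_sum[symmetric] sum_negf sum_divide_distrib flip: exp_of_real)
  qed
  have char1: "(CLINT w|M. iexp (c * X (e j) w)) = exp (- of_real (c\<^sup>2) / 2)" for c j
    using char[of "{j}" "\<lambda>_. c"] by simp
  show "indep_vars (\<lambda>_. borel) (\<lambda>i. X (e i)) UNIV"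
  proof (rule indep_vars_if_char_factor)
    show "(CLINT w|M. iexp (\<Sum>j\<in>J. c j * X (e j) w)) = (\<Prod>j\<in>J. CLINT w|M. iexp (c j * X (e j) w))"
      if "finite J" for J c
      unfolding char[OF that] char1 ..
  qed measurable
  show "distr M borel (X (e i)) = std_normal_distribution"
  proof (rule Levy_uniqueness[OF real_distribution_distr real_dist_normal_dist])
    show "char (distr M borel (X (e i))) = char std_normal_distribution"
      unfolding char_std_normal_distribution using char1[of _ i]
      by (simp add: fun_eq_iff char_def integral_distr flip: exp_of_real)
  qed measurable
qed

section \<open>The chaos expansion of a double integral\<close>

lemma subspace_closure_subspace:
  fixes V :: "'v::real_normed_vector set"
  assumes V: "subspace V"
  shows "subspace (closure V)"
  unfolding subspace_def
proof (intro conjI ballI allI)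
  show "0 \<in> closure V" using subspace_0[OF V] closure_subset by blast
next
  fix a b assume "a \<in> closure V" "b \<in> closure V"
  then obtain x y where "\<And>n. x n \<in> V" "x \<longlonglongrightarrow> a" "\<And>n. y n \<in> V" "y \<longlonglongrightarrow> b"
    unfolding closure_sequential by auto
  then show "a + b \<in> closure V"
    unfolding closure_sequential
    by (intro exI[of _ "\<lambda>n. x n + y n"]) (auto intro: subspace_add[OF V] tendsto_add)
next
  fix c :: real and a assume "a \<in> closure V"
  then obtain x where "\<And>n. x n \<in> V" "x \<longlonglongrightarrow> a"
    unfolding closure_sequential by auto
  then show "c *\<^sub>R a \<in> closure V"
    unfolding closure_sequential
    by (intro exI[of _ "\<lambda>n. c *\<^sub>R x n"]) (auto intro: subspace_scale[OF V] tendsto_scaleR)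
qed

lemma subspace_symmetric_tensors: "subspace (symmetric_tensors T)"
  unfolding symmetric_tensors_def by (rule subspace_closure_subspace[OF subspace_span])

lemma tensor_square_in_symmetric_tensors: "T h h \<in> symmetric_tensors T"
proof -
  have "T h h = (1/2) *\<^sub>R (T h h + T h h)" by (rule scaleR_half_double[symmetric])
  then have "T h h \<in> {(1/2) *\<^sub>R (T a b + T b a) | a b. True}"
    by (intro CollectI exI[of _ h] conjI TrueI)
  then show ?thesis
    unfolding symmetric_tensors_def by (intro subsetD[OF closure_subset] span_base)
qed

text \<open>
  The partial sums of \<open>f\<close> are mapped to the partial sums of the chaos expansion, so the isometry
  property turns convergence of the former into \<open>L\<^sup>2\<close> convergence of the latter.
\<close>

lemma double_stochastic_integral_expansion:
  fixes X :: "'h::real_inner \<Rightarrow> 'w \<Rightarrow> real" and T :: "'h \<Rightarrow> 'h \<Rightarrow> 'k::real_inner"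
  assumes M: "prob_space M" and I2: "double_stochastic_integral M T X I2"
    and Xm: "\<And>h. X h \<in> borel_measurable M"
    and f: "f \<in> symmetric_tensors T" and sums: "(\<lambda>i. lam i *\<^sub>R T (e i) (e i)) sums f"
    and e: "\<And>i. norm (e i :: 'h) = 1"
  defines "S \<equiv> \<lambda>n w. \<Sum>i<n. lam i * ((X (e i) w)\<^sup>2 - 1)"
  shows "(\<lambda>n. \<integral>w. (I2 f w - S n w)\<^sup>2 \<partial>M) \<longlonglongrightarrow> 0"
    and "(\<lambda>n. \<integral>w. (S n w)\<^sup>2 \<partial>M) \<longlonglongrightarrow> (\<integral>w. (I2 f w)\<^sup>2 \<partial>M)"
proof -
  define fn where "fn = (\<lambda>n. \<Sum>i<n. lam i *\<^sub>R T (e i) (e i))"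
  note sub = subspace_symmetric_tensors[of T]
  have I2m: "I2 g \<in> borel_measurable M" if "g \<in> symmetric_tensors T" for g
    using I2 that by (simp add: double_stochastic_integral_def)
  have lin: "AE w in M. I2 (a *\<^sub>R g + b *\<^sub>R h) w = a * I2 g w + b * I2 h w"
    if "g \<in> symmetric_tensors T" "h \<in> symmetric_tensors T" for a b g h
    using I2 that by (simp add: double_stochastic_integral_def)
  have iso: "(\<integral>w. (I2 g w)\<^sup>2 \<partial>M) = 2 * (norm g)\<^sup>2" if "g \<in> symmetric_tensors T" for g
    using I2 that by (simp add: double_stochastic_integral_def)
  have sq: "AE w in M. I2 (T h h) w = (X h w)\<^sup>2 - 1" if "norm h = 1" for h
    using I2 that by (simp add: double_stochastic_integral_def)
  note [measurable] = Xm
  have Sm [measurable]: "S n \<in> borel_measurable M" for n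
    unfolding S_def by measurable
  have fn: "fn n \<in> symmetric_tensors T" for n
    unfolding fn_def
    by (intro subspace_sum[OF sub] subspace_scale[OF sub] tensor_square_in_symmetric_tensors)
  have AE_fn: "AE w in M. I2 (fn n) w = S n w" for n
  proof (induction n)
    case 0
    \<comment> \<open>Linearity holds only almost everywhere, so even \<open>I2 0 = 0\<close> is an
      almost sure identity, taken from the zero combination of \<open>f\<close> with itself.\<close>
    show ?case using lin[OF f f, of 0 0] by (simp add: fn_def S_def)
  next
    case (Suc n)
    have "fn (Suc n) = 1 *\<^sub>R fn n + lam n *\<^sub>R T (e n) (e n)"
      by (simp add: fn_def)
    then have "AE w in M. I2 (fn (Suc n)) w = 1 * I2 (fn n) w + lam n * I2 (T (e n) (e n)) w"
      using lin[OF fn[of n] tensor_square_in_symmetric_tensors, of 1 "lam n" "e n"] by simp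
    with Suc sq[OF e[of n]] show ?case
      by eventually_elim (simp add: S_def)
  qed
  have lim: "fn \<longlonglongrightarrow> f" using sums by (simp add: sums_def fn_def)
  have "(\<integral>w. (I2 f w - S n w)\<^sup>2 \<partial>M) = 2 * (norm (f - fn n))\<^sup>2" for n
  proof -
    have "f - fn n = 1 *\<^sub>R f + (-1) *\<^sub>R fn n" by simp
    then have "AE w in M. I2 (f - fn n) w = I2 f w - I2 (fn n) w"
      using lin[OF f fn[of n], of 1 "-1"] by simp
    then have "AE w in M. (I2 f w - S n w)\<^sup>2 = (I2 (f - fn n) w)\<^sup>2"
      using AE_fn[of n] by eventually_elim simp
    then have "(\<integral>w. (I2 f w - S n w)\<^sup>2 \<partial>M) = (\<integral>w. (I2 (f - fn n) w)\<^sup>2 \<partial>M)"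
      using I2m[OF f] I2m[OF subspace_diff[OF sub f fn[of n]]] by (intro integral_cong_AE) auto
    then show ?thesis using iso[OF subspace_diff[OF sub f fn[of n]]] by simp
  qed
  moreover have "(\<lambda>n. 2 * (norm (f - fn n))\<^sup>2) \<longlonglongrightarrow> 2 * (norm (f - f))\<^sup>2"
    by (intro tendsto_intros lim)
  ultimately show "(\<lambda>n. \<integral>w. (I2 f w - S n w)\<^sup>2 \<partial>M) \<longlonglongrightarrow> 0" by simp
  \<comment> \<open>Combined with the explicit variance of the partial sums, convergence of second
    moments yields that the squared eigenvalues sum to half the second moment of
    \<open>F\<close>.\<close>
  have "(\<integral>w. (S n w)\<^sup>2 \<partial>M) = 2 * (norm (fn n))\<^sup>2" for n
  proof -
    have "(\<integral>w. (S n w)\<^sup>2 \<partial>M) = (\<integral>w. (I2 (fn n) w)\<^sup>2 \<partial>M)"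
      by (rule integral_cong_AE) (use I2m[OF fn[of n]] AE_fn[of n] in auto)
    then show ?thesis using iso[OF fn[of n]] by simp
  qed
  moreover have "(\<lambda>n. 2 * (norm (fn n))\<^sup>2) \<longlonglongrightarrow> 2 * (norm f)\<^sup>2"
    by (intro tendsto_intros lim)
  ultimately show "(\<lambda>n. \<integral>w. (S n w)\<^sup>2 \<partial>M) \<longlonglongrightarrow> (\<integral>w. (I2 f w)\<^sup>2 \<partial>M)"
    by (simp add: iso[OF f])
qed

theorem theorem7p2:
  shows "\<exists>C :: nat \<Rightarrow> real \<Rightarrow> real. (\<forall>N l. 0 < C N l) \<and>
    (\<forall>(M :: 'w measure)
      (X :: 'h::{real_inner, complete_space, second_countable_topology} \<Rightarrow> 'w \<Rightarrow> real)
      (T :: 'h \<Rightarrow> 'h \<Rightarrow> 'k::{real_inner, complete_space})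
      (I2 :: 'k \<Rightarrow> 'w \<Rightarrow> real) (f :: 'k) (lam :: nat \<Rightarrow> real) (e :: nat \<Rightarrow> 'h) (m :: nat) (N :: nat).
      prob_space M \<longrightarrow>
      isonormal_process M X \<longrightarrow>
      hilbert_tensor_square T \<longrightarrow>
      double_stochastic_integral M T X I2 \<longrightarrow>
      f \<in> symmetric_tensors T \<longrightarrow>
      orthonormal_basis e \<longrightarrow>
      (\<forall>i. hilbert_schmidt_operator T f (e i) = lam i *\<^sub>R e i) \<longrightarrow>
      (\<forall>i. \<bar>lam (Suc i)\<bar> \<le> \<bar>lam i\<bar>) \<longrightarrow>
      (\<lambda>i. lam i *\<^sub>R T (e i) (e i)) sums f \<longrightarrow>
      \<comment> \<open>sequences are indexed from 0 here, so \<open>lam (N - 1)\<close> is the \<open>N\<close>-th eigenvalue\<close>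
      N > 6 * m + 6 * max (m div 2) 1 \<longrightarrow>
      lam (N - 1) \<noteq> 0 \<longrightarrow>
      (let F = I2 f; \<phi> = normal_density 0 (sqrt (\<integral>w. (F w)\<^sup>2 \<partial>M)) in
       \<exists>fF :: real \<Rightarrow> real.
         (\<forall>x. 0 \<le> fF x) \<and>
         distributed M lborel F (\<lambda>x. ennreal (fF x)) \<and>
         continuously_differentiable m fF \<and>
         (\<forall>k\<le>m.
           bdd_above (range (\<lambda>x. \<bar>(deriv ^^ k) fF x - (deriv ^^ k) \<phi> x\<bar>)) \<and>
           (SUP x. \<bar>(deriv ^^ k) fF x - (deriv ^^ k) \<phi> x\<bar>)
             \<le> C N (lam (N - 1)) * sqrt (\<Sum>i. lam i ^ 4) \<and>
           C N (lam (N - 1)) * sqrt (\<Sum>i. lam i ^ 4)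
             \<le> C N (lam (N - 1)) *
                sqrt ((\<integral>w. F w ^ 4 \<partial>M) - 3 * (\<integral>w. (F w)\<^sup>2 \<partial>M)\<^sup>2))))"
proof (intro exI[of _ "\<lambda>N l. if l = 0 then 1 else decay_constant N l / l\<^sup>2"] conjI allI impI, goal_cases)
  \<comment> \<open>The value 1 at \<open>l = 0\<close> is there only for positivity:
    \<open>decay_constant N 0 / 0\<close> would be 0.\<close>
  case (1 N l)
  then show ?case by (auto simp: decay_constant_def min_def)
next
  case (2 M X T I2 f lam e m N)
  note X = 2(2) and I2 = 2(4) and f = 2(5) and dec = 2(8)[rule_format] and sums = 2(9) and N = 2(10) and l = 2(11)
  interpret prob_space M by fact
  have ee: "inner (e i) (e j) = (if i = j then 1 else 0)" for i j
    using 2(6) by (simp add: orthonormal_basis_def)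
  note ind = isonormal_process_indep_std_normal[OF prob_space_axioms X ee]
  interpret Q: gaussian_quadratic_form M "\<lambda>i. X (e i)" lam
    by unfold_locales (fact ind)+
  define F where "F = I2 f"
  have Fm: "F \<in> borel_measurable M" and F2: "integrable M (\<lambda>w. (F w)\<^sup>2)"
    using I2 f by (auto simp: F_def double_stochastic_integral_def)
  have Xm: "X h \<in> borel_measurable M" for h
  proof -
    have "\<forall>S c. finite S \<longrightarrow> centered_gaussian M (\<lambda>w. \<Sum>h\<in>S. c h * X h w)"
      using X by (simp add: isonormal_process_def)
    from this[rule_format, of "{h}" "\<lambda>_. 1"] show ?thesis by (simp add: centered_gaussian_def)
  qed
  have "norm (e i) = 1" for i by (simp add: norm_eq_sqrt_inner ee)
  note exp = double_stochastic_integral_expansion[OF prob_space_axioms I2 Xm f sums this, folded F_def]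
  have S: "Q.S n = (\<lambda>w. \<Sum>i<n. lam i * ((X (e i) w)\<^sup>2 - 1))" for n
    by (simp add: Q.S_def Q.Y_def fun_eq_iff)
  have lim: "(\<lambda>n. expectation (\<lambda>w. (F w - Q.S n w)\<^sup>2)) \<longlonglongrightarrow> 0"
    unfolding S by (rule exp(1))
  have "(\<lambda>n. expectation (\<lambda>w. (Q.S n w)\<^sup>2) / 2) \<longlonglongrightarrow> expectation (\<lambda>w. (F w)\<^sup>2) / 2"
    unfolding S by (intro tendsto_intros exp(2)) simp
  then have sq: "(\<lambda>i. (lam i)\<^sup>2) sums (expectation (\<lambda>w. (F w)\<^sup>2) / 2)"
    by (simp add: Q.expectation_S_square sums_def)
  have "2 * m + 6 \<le> N" using N by (auto simp: max_def split: if_splits)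
  from Q.smooth_density_limit[OF Fm F2 lim sq dec l this]
  obtain fF where fF: "\<And>x. 0 \<le> fF x" "distributed M lborel F (\<lambda>x. ennreal (fF x))" "continuously_differentiable m fF"
    and bound: "\<And>k x. k \<le> m \<Longrightarrow> \<bar>(deriv ^^ k) fF x - (deriv ^^ k) (normal_density 0 (sqrt (expectation (\<lambda>w. (F w)\<^sup>2)))) x\<bar>
       \<le> decay_constant N (lam (N - 1))" by blast
  let ?C = "decay_constant N (lam (N - 1)) / (lam (N - 1))\<^sup>2"
  have C0: "?C \<ge> 0" by (simp add: decay_constant_def)
  have s4: "summable (\<lambda>i. lam i ^ 4)" by (intro summable_fourth_powers sums_summable[OF sq])
  have "(lam (N - 1))\<^sup>2 = sqrt (lam (N - 1) ^ 4)"
    by (rule real_sqrt_unique[symmetric]) (simp_all flip: power_mult)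
  also have "\<dots> \<le> sqrt (\<Sum>i. lam i ^ 4)"
    using sum_le_suminf[OF s4, of "{N - 1}"] by simp
  finally have "?C * (lam (N - 1))\<^sup>2 \<le> ?C * sqrt (\<Sum>i. lam i ^ 4)"
    using C0 by (rule mult_left_mono)
  then have C1: "decay_constant N (lam (N - 1)) \<le> ?C * sqrt (\<Sum>i. lam i ^ 4)"
    using l by simp
  \<comment> \<open>Nonnegativity of the sum allows the factor 48 to be lowered to 1.\<close>
  have "0 \<le> (\<Sum>i. lam i ^ 4)" by (intro suminf_nonneg s4) simp
  with Q.fourth_moment_limit[OF Fm F2 lim sq]
  have "(\<Sum>i. lam i ^ 4) \<le> expectation (\<lambda>w. F w ^ 4) - 3 * (expectation (\<lambda>w. (F w)\<^sup>2))\<^sup>2"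
    by linarith
  then have C2: "?C * sqrt (\<Sum>i. lam i ^ 4) \<le> ?C * sqrt (expectation (\<lambda>w. F w ^ 4) - 3 * (expectation (\<lambda>w. (F w)\<^sup>2))\<^sup>2)"
    using C0 by (intro mult_left_mono real_sqrt_le_mono)
  show ?case
    unfolding Let_def F_def[symmetric]
  proof (intro exI[of _ fF] conjI allI impI fF)
    fix k assume k: "k \<le> m"
    let ?d = "\<lambda>x. \<bar>(deriv ^^ k) fF x - (deriv ^^ k) (normal_density 0 (sqrt (expectation (\<lambda>w. (F w)\<^sup>2)))) x\<bar>"
    show "bdd_above (range ?d)"
      using bound[OF k] by (auto intro!: bdd_aboveI)
    have "(SUP x. ?d x) \<le> decay_constant N (lam (N - 1))"
      using bound[OF k] by (intro cSUP_least) auto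
    then show "(SUP x. ?d x) \<le> (if lam (N - 1) = 0 then 1 else ?C) * sqrt (\<Sum>i. lam i ^ 4)"
      using C1 l by simp
    show "(if lam (N - 1) = 0 then 1 else ?C) * sqrt (\<Sum>i. lam i ^ 4) \<le>
      (if lam (N - 1) = 0 then 1 else ?C) * sqrt (expectation (\<lambda>w. F w ^ 4) - 3 * (expectation (\<lambda>w. (F w)\<^sup>2))\<^sup>2)"
      using C2 l by simp
  qed
qed

end
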